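(* Let $G$ be a semisimple Lie group with Lie algebra $\mathfrak{g}$, Killing form $\kappa$, and a left-invariant Riemannian metric given by $\langle u,v\rangle=\kappa(u,\Lambda v)$ for an invertible symmetric operator $\Lambda$ on $\mathfrak{g}$. Let $u_0\in\mathfrak{g}$ be a regular semisimple element. Suppose that $\Lambda u_0$ is also a regular element that commutes with $u_0$, and that $\mathrm{ad}_{u_0}^2$ has a nonzero real eigenvalue with eigenspace $V\subset\mathfrak{g}$. Suppose in addition that $\Lambda$ maps $V$ to itself. (i) If $\mathrm{ad}_{u_0}$ has purely imaginary eigenvalues on $V$, then there is a conjugate point along the homogeneous geodesic $\gamma(t)=\exp(tu_0)$. (ii) If $\mathrm{ad}_{u_0}$ has purely real eigenvalues on $V$, then there is a conjugate point along $\gamma$ arising from a Jacobi field $J$ with $J'(0)\in V$ if and only if $u_0$ is stable in the Eulerian sense under perturbations in $V$.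
   Context: An element of $\mathfrak{g}$ is regular if its centralizer has minimal dimension, so that for a semisimple regular element the centralizer is a Cartan subalgebra; an element $u$ is semisimple if $\mathrm{ad}_u$ is diagonalizable over $\mathbb{C}$. For $u,v\in\mathfrak{g}$, $\mathrm{ad}^\star_uv$ is defined by $\langle\mathrm{ad}^\star_uv,w\rangle=\langle v,\mathrm{ad}_uw\rangle$ for all $w\in\mathfrak{g}$. Since $[u_0,\Lambda u_0]=0$, we have $\mathrm{ad}^\star_{u_0}u_0=0$ and $t\mapsto\exp(tu_0)$ is a geodesic. Jacobi fields along $\gamma$ have the form $J(t)=DL_{\gamma(t)}y(t)$, where $L_g$ is left translation by $g$, $y'+\mathrm{ad}_{u_0}y=z$ and $z'=Fz$ with $F(z)=\mathrm{ad}^\star_{u_0}z+\mathrm{ad}^\star_zu_0=\Lambda^{-1}(\mathrm{ad}_{\Lambda u_0}-\mathrm{ad}_{u_0}\Lambda)z$; for $J(0)=0$, the condition $J'(0)\in V$ means $y(0)=0$ and $y'(0)=z(0)\in V$. A conjugate point along $\gamma$ occurs at time $\tau>0$ if some nontrivial Jacobi field along $\gamma$ vanishes at $t=0$ and $t=\tau$. $u_0$ is stable in the Eulerian sense under perturbations in $V$ if every solution $z(t)$ of $z'=Fz$ with $z(0)\in V$ remains bounded for all time.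
   Formalization: In (ii), the implication from a conjugate point with J'(0) in V to Eulerian stability under perturbations in V is stated only for dim V = 2; it is false for larger V, e.g. on SL(2,R)×SL(2,R) with u_0=(h,h) and a product metric with one stable and one unstable factor. *)

theory Defs
  imports "HOL-Analysis.Analysis" "HOL-Algebra.Group"
begin

section \<open>Lie groups\<close>

text \<open>For functions on open sets: \<open>Ck_on k S f\<close> says that all iterated directional derivatives
  of \<open>f\<close> of order at most \<open>k\<close> exist and are continuous, those of order less than \<open>k\<close> being
  Frechet differentiable.\<close>

primrec Ck_on :: "nat \<Rightarrow> 'a::real_normed_vector set \<Rightarrow> ('a \<Rightarrow> 'b::real_normed_vector) \<Rightarrow> bool" where
  "Ck_on 0 S f \<longleftrightarrow> continuous_on S f"
| "Ck_on (Suc k) S f \<longleftrightarrow>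
     f differentiable_on S \<and> (\<forall>v. Ck_on k S (\<lambda>x. frechet_derivative f (at x) v))"

definition smooth_on :: "'a::real_normed_vector set \<Rightarrow> ('a \<Rightarrow> 'b::real_normed_vector) \<Rightarrow> bool" where
  "smooth_on S f \<longleftrightarrow> (\<forall>k. Ck_on k S f)"

text \<open>A chart is a pair of its domain and its coordinate map; only the values of the coordinate map
  on the domain matter.\<close>

type_synonym ('p, 'a) chart = "'p set \<times> ('p \<Rightarrow> 'a)"

definition smooth_map ::
  "'p topology \<Rightarrow> ('p, 'a::real_normed_vector) chart set \<Rightarrow>
   'q topology \<Rightarrow> ('q, 'b::real_normed_vector) chart set \<Rightarrow> ('p \<Rightarrow> 'q) \<Rightarrow> bool" where
  "smooth_map T A T' A' f \<longleftrightarrow>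
     continuous_map T T' f \<and>
     (\<forall>(U, \<phi>)\<in>A. \<forall>(W, \<psi>)\<in>A'. smooth_on (\<phi> ` (U \<inter> f -` W)) (\<psi> \<circ> f \<circ> inv_into U \<phi>))"

definition smooth_manifold :: "'p topology \<Rightarrow> ('p, 'a::euclidean_space) chart set \<Rightarrow> bool" where
  "smooth_manifold T A \<longleftrightarrow>
     Hausdorff_space T \<and> second_countable T \<and> (\<Union>(U, \<phi>)\<in>A. U) = topspace T \<and>
     (\<forall>(U, \<phi>)\<in>A. openin T U \<and> open (\<phi> ` U) \<and>
        homeomorphic_map (subtopology T U) (top_of_set (\<phi> ` U)) \<phi>) \<and>
     (\<forall>(U, \<phi>)\<in>A. \<forall>(W, \<psi>)\<in>A. smooth_on (\<phi> ` (U \<inter> W)) (\<psi> \<circ> inv_into U \<phi>))"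

definition prod_charts ::
  "('p, 'a) chart set \<Rightarrow> ('q, 'b) chart set \<Rightarrow> ('p \<times> 'q, 'a \<times> 'b) chart set" where
  "prod_charts A A' = {(U \<times> W, map_prod \<phi> \<psi>) | U \<phi> W \<psi>. (U, \<phi>) \<in> A \<and> (W, \<psi>) \<in> A'}"

abbreviation real_charts :: "(real, real) chart set" where
  "real_charts \<equiv> {(UNIV, \<lambda>x. x)}"

record ('g, 'a) manifold_monoid = "'g monoid" +
  gtop :: "'g topology"
  gcharts :: "('g, 'a) chart set"

definition lie_group :: "('g, 'a::euclidean_space, 'm) manifold_monoid_scheme \<Rightarrow> bool" where
  "lie_group G \<longleftrightarrow>
     group G \<and> topspace (gtop G) = carrier G \<and> smooth_manifold (gtop G) (gcharts G) \<and>
     smooth_map (prod_topology (gtop G) (gtop G)) (prod_charts (gcharts G) (gcharts G))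
       (gtop G) (gcharts G) (\<lambda>(g, h). g \<otimes>\<^bsub>G\<^esub> h) \<and>
     smooth_map (gtop G) (gcharts G) (gtop G) (gcharts G) (\<lambda>g. inv\<^bsub>G\<^esub> g)"

definition smooth_functions ::
  "('g, 'a::euclidean_space, 'm) manifold_monoid_scheme \<Rightarrow> ('g \<Rightarrow> real) set" where
  "smooth_functions G = {f. smooth_map (gtop G) (gcharts G) euclideanreal real_charts f}"

text \<open>Tangent vectors are point derivations of the algebra of smooth functions, normalised to vanish
  outside that algebra so that equality of tangent vectors is equality of functionals.\<close>

type_synonym 'g tangent = "('g \<Rightarrow> real) \<Rightarrow> real"

abbreviation zero_tangent :: "'g tangent" where
  "zero_tangent \<equiv> (\<lambda>f. 0)"

definition tangent_space ::
  "('g, 'a::euclidean_space, 'm) manifold_monoid_scheme \<Rightarrow> 'g \<Rightarrow> 'g tangent set" where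
  "tangent_space G g = {X.
     (\<forall>f\<in>smooth_functions G. \<forall>h\<in>smooth_functions G.
        X (\<lambda>p. f p + h p) = X f + X h \<and> X (\<lambda>p. f p * h p) = X f * h g + f g * X h) \<and>
     (\<forall>f\<in>smooth_functions G. \<forall>r. X (\<lambda>p. r * f p) = r * X f) \<and>
     (\<forall>f. f \<notin> smooth_functions G \<longrightarrow> X f = 0)}"

text \<open>\<open>DL G g\<close> is the differential of left translation by \<open>g\<close>.\<close>

definition DL ::
  "('g, 'a::euclidean_space, 'm) manifold_monoid_scheme \<Rightarrow> 'g \<Rightarrow> 'g tangent \<Rightarrow> 'g tangent" where
  "DL G g X = (\<lambda>f. if f \<in> smooth_functions G then X (\<lambda>h. f (g \<otimes>\<^bsub>G\<^esub> h)) else 0)"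

text \<open>The value at the identity of the commutator of the left-invariant vector fields
  \<open>g \<mapsto> DL G g X\<close> and \<open>g \<mapsto> DL G g Y\<close>.\<close>

definition left_invariant_bracket ::
  "('g, 'a::euclidean_space, 'm) manifold_monoid_scheme \<Rightarrow> 'g tangent \<Rightarrow> 'g tangent \<Rightarrow> 'g tangent" where
  "left_invariant_bracket G X Y =
     (\<lambda>f. if f \<in> smooth_functions G then X (\<lambda>g. DL G g Y f) - Y (\<lambda>g. DL G g X f) else 0)"

definition left_invariant_metric ::
  "('g, 'a::euclidean_space, 'm) manifold_monoid_scheme \<Rightarrow>
   ('g \<Rightarrow> 'g tangent \<Rightarrow> 'g tangent \<Rightarrow> real) \<Rightarrow> bool" where
  \<comment> \<open>smooth dependence on the base point is automatic, by left-invariance\<close>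
  "left_invariant_metric G M \<longleftrightarrow>
     (\<forall>g\<in>carrier G. \<forall>X\<in>tangent_space G g. \<forall>Y\<in>tangent_space G g. \<forall>Z\<in>tangent_space G g. \<forall>r s.
        M g X Y = M g Y X \<and>
        M g (\<lambda>f. r * X f + s * Y f) Z = r * M g X Z + s * M g Y Z \<and>
        (X \<noteq> zero_tangent \<longrightarrow> M g X X > 0)) \<and>
     (\<forall>g\<in>carrier G. \<forall>h\<in>carrier G. \<forall>X\<in>tangent_space G h. \<forall>Y\<in>tangent_space G h.
        M (g \<otimes>\<^bsub>G\<^esub> h) (DL G g X) (DL G g Y) = M h X Y)"

text \<open>\<open>\<gamma>(t) = exp (t u)\<close>, i.e. \<open>\<gamma>\<close> is the one-parameter subgroup of \<open>G\<close> with initial velocity \<open>X\<close>,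
  the tangent vector at the identity corresponding to \<open>u\<close>.\<close>

definition one_parameter_subgroup ::
  "('g, 'a::euclidean_space, 'm) manifold_monoid_scheme \<Rightarrow> 'g tangent \<Rightarrow> (real \<Rightarrow> 'g) \<Rightarrow> bool" where
  "one_parameter_subgroup G X \<gamma> \<longleftrightarrow>
     smooth_map euclideanreal real_charts (gtop G) (gcharts G) \<gamma> \<and>
     (\<forall>s t. \<gamma> (s + t) = \<gamma> s \<otimes>\<^bsub>G\<^esub> \<gamma> t) \<and>
     (\<forall>f\<in>smooth_functions G. ((\<lambda>t. f (\<gamma> t)) has_real_derivative X f) (at 0))"

section \<open>Lie algebras\<close>

text \<open>A Lie algebra of dimension \<open>DIM('a)\<close> is a bracket on the vector space \<open>'a\<close>. The inner product
  and the standard basis of \<open>'a\<close> are auxiliary: nothing below depends on them.\<close>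

definition lie_algebra :: "('a::euclidean_space \<Rightarrow> 'a \<Rightarrow> 'a) \<Rightarrow> bool" where
  "lie_algebra br \<longleftrightarrow>
     bilinear br \<and> (\<forall>u. br u u = 0) \<and>
     (\<forall>u v w. br u (br v w) + br v (br w u) + br w (br u v) = 0)"

text \<open>\<open>\<iota>\<close> identifies the Lie algebra \<open>br\<close> with the tangent space of \<open>G\<close> at the identity. The
  Lie algebra laws in the first conjunct are implied by the others.\<close>

definition lie_algebra_of ::
  "('g, 'a::euclidean_space, 'm) manifold_monoid_scheme \<Rightarrow> ('a \<Rightarrow> 'a \<Rightarrow> 'a) \<Rightarrow> ('a \<Rightarrow> 'g tangent) \<Rightarrow> bool"
where
  "lie_algebra_of G br \<iota> \<longleftrightarrow>
     lie_algebra br \<and>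
     bij_betw \<iota> UNIV (tangent_space G \<one>\<^bsub>G\<^esub>) \<and>
     (\<forall>r s u v. \<iota> (r *\<^sub>R u + s *\<^sub>R v) = (\<lambda>f. r * \<iota> u f + s * \<iota> v f)) \<and>
     (\<forall>u v. \<iota> (br u v) = left_invariant_bracket G (\<iota> u) (\<iota> v))"

definition lie_ideal :: "('a::euclidean_space \<Rightarrow> 'a \<Rightarrow> 'a) \<Rightarrow> 'a set \<Rightarrow> bool" where
  "lie_ideal br I \<longleftrightarrow> subspace I \<and> (\<forall>x. \<forall>y\<in>I. br x y \<in> I)"

definition derived_algebra :: "('a::euclidean_space \<Rightarrow> 'a \<Rightarrow> 'a) \<Rightarrow> 'a set \<Rightarrow> 'a set" where
  "derived_algebra br I = span {br x y | x y. x \<in> I \<and> y \<in> I}"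

definition lie_solvable :: "('a::euclidean_space \<Rightarrow> 'a \<Rightarrow> 'a) \<Rightarrow> 'a set \<Rightarrow> bool" where
  "lie_solvable br I \<longleftrightarrow> (\<exists>n. (derived_algebra br ^^ n) I = {0})"

definition lie_semisimple :: "('a::euclidean_space \<Rightarrow> 'a \<Rightarrow> 'a) \<Rightarrow> bool" where
  "lie_semisimple br \<longleftrightarrow> (\<forall>I. lie_ideal br I \<and> lie_solvable br I \<longrightarrow> I = {0})"

definition lin_trace :: "('a::euclidean_space \<Rightarrow> 'a) \<Rightarrow> real" where
  "lin_trace f = (\<Sum>b\<in>Basis. f b \<bullet> b)"

definition killing_form :: "('a::euclidean_space \<Rightarrow> 'a \<Rightarrow> 'a) \<Rightarrow> 'a \<Rightarrow> 'a \<Rightarrow> real" where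
  "killing_form br u v = lin_trace (\<lambda>w. br u (br v w))"

definition lie_centralizer :: "('a::euclidean_space \<Rightarrow> 'a \<Rightarrow> 'a) \<Rightarrow> 'a \<Rightarrow> 'a set" where
  "lie_centralizer br u = {v. br u v = 0}"

definition regular_element :: "('a::euclidean_space \<Rightarrow> 'a \<Rightarrow> 'a) \<Rightarrow> 'a \<Rightarrow> bool" where
  "regular_element br u \<longleftrightarrow> (\<forall>v. dim (lie_centralizer br u) \<le> dim (lie_centralizer br v))"

text \<open>The complexification of a real vector space \<open>'a\<close> is \<open>'a \<times> 'a\<close>, with \<open>(x, y)\<close> standing for
  \<open>x + \<i> y\<close>; the complexification of a linear map \<open>f\<close> is \<open>map_prod f f\<close>.\<close>

definition cscale :: "complex \<Rightarrow> 'a::real_vector \<times> 'a \<Rightarrow> 'a \<times> 'a" where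
  "cscale c = (\<lambda>(x, y). (Re c *\<^sub>R x - Im c *\<^sub>R y, Re c *\<^sub>R y + Im c *\<^sub>R x))"

interpretation cplx: vector_space cscale
  by unfold_locales (auto simp: cscale_def algebra_simps)

definition diagonalizable_over_C :: "('a::euclidean_space \<Rightarrow> 'a) \<Rightarrow> bool" where
  "diagonalizable_over_C f \<longleftrightarrow>
     (\<exists>B. cplx.independent B \<and> cplx.span B = UNIV \<and> (\<forall>b\<in>B. \<exists>c. map_prod f f b = cscale c b))"

definition semisimple_element :: "('a::euclidean_space \<Rightarrow> 'a \<Rightarrow> 'a) \<Rightarrow> 'a \<Rightarrow> bool" where
  "semisimple_element br u \<longleftrightarrow> diagonalizable_over_C (br u)"

definition complex_eigenvalue_on :: "('a::euclidean_space \<Rightarrow> 'a) \<Rightarrow> 'a set \<Rightarrow> complex \<Rightarrow> bool" where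
  "complex_eigenvalue_on f V c \<longleftrightarrow> (\<exists>w\<in>V \<times> V. w \<noteq> 0 \<and> map_prod f f w = cscale c w)"

section \<open>Jacobi fields, conjugate points and Eulerian stability\<close>

definition metric_at_one ::
  "('g, 'a::euclidean_space, 'm) manifold_monoid_scheme \<Rightarrow> ('a \<Rightarrow> 'g tangent) \<Rightarrow>
   ('g \<Rightarrow> 'g tangent \<Rightarrow> 'g tangent \<Rightarrow> real) \<Rightarrow> 'a \<Rightarrow> 'a \<Rightarrow> real" where
  "metric_at_one G \<iota> M u v = M \<one>\<^bsub>G\<^esub> (\<iota> u) (\<iota> v)"

definition ad_star ::
  "('a::euclidean_space \<Rightarrow> 'a \<Rightarrow> 'a) \<Rightarrow> ('a \<Rightarrow> 'a \<Rightarrow> real) \<Rightarrow> 'a \<Rightarrow> 'a \<Rightarrow> 'a" where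
  "ad_star br ip u v = (THE x. \<forall>w. ip x w = ip v (br u w))"

definition euler_linearization ::
  "('a::euclidean_space \<Rightarrow> 'a \<Rightarrow> 'a) \<Rightarrow> ('a \<Rightarrow> 'a \<Rightarrow> real) \<Rightarrow> 'a \<Rightarrow> 'a \<Rightarrow> 'a" where
  "euler_linearization br ip u0 z = ad_star br ip u0 z + ad_star br ip z u0"

definition linearized_euler_solution ::
  "('a::euclidean_space \<Rightarrow> 'a \<Rightarrow> 'a) \<Rightarrow> ('a \<Rightarrow> 'a \<Rightarrow> real) \<Rightarrow> 'a \<Rightarrow> (real \<Rightarrow> 'a) \<Rightarrow> bool" where
  "linearized_euler_solution br ip u0 z \<longleftrightarrow>
     (\<forall>t. (z has_vector_derivative euler_linearization br ip u0 (z t)) (at t))"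

definition jacobi_field ::
  "('g, 'a::euclidean_space, 'm) manifold_monoid_scheme \<Rightarrow> ('a \<Rightarrow> 'a \<Rightarrow> 'a) \<Rightarrow> ('a \<Rightarrow> 'g tangent) \<Rightarrow>
   ('g \<Rightarrow> 'g tangent \<Rightarrow> 'g tangent \<Rightarrow> real) \<Rightarrow> 'a \<Rightarrow> (real \<Rightarrow> 'g) \<Rightarrow> (real \<Rightarrow> 'a) \<Rightarrow> (real \<Rightarrow> 'g tangent) \<Rightarrow> bool"
where
  "jacobi_field G br \<iota> M u0 \<gamma> y J \<longleftrightarrow>
     (\<forall>t. J t = DL G (\<gamma> t) (\<iota> (y t))) \<and>
     (\<exists>z. linearized_euler_solution br (metric_at_one G \<iota> M) u0 z \<and>
          (\<forall>t. (y has_vector_derivative z t - br u0 (y t)) (at t)))"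

text \<open>For a Jacobi field \<open>J\<close> with \<open>J 0 = 0\<close>, \<open>y' 0\<close> is \<open>J' 0\<close> under the identification of the
  tangent space at the identity with the Lie algebra. All conjugate points are obtained with
  \<open>W = UNIV\<close>.\<close>

definition conjugate_time ::
  "('g, 'a::euclidean_space, 'm) manifold_monoid_scheme \<Rightarrow> ('a \<Rightarrow> 'a \<Rightarrow> 'a) \<Rightarrow> ('a \<Rightarrow> 'g tangent) \<Rightarrow>
   ('g \<Rightarrow> 'g tangent \<Rightarrow> 'g tangent \<Rightarrow> real) \<Rightarrow> 'a \<Rightarrow> (real \<Rightarrow> 'g) \<Rightarrow> 'a set \<Rightarrow> real \<Rightarrow> bool" where
  "conjugate_time G br \<iota> M u0 \<gamma> W \<tau> \<longleftrightarrow>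
     \<tau> > 0 \<and>
     (\<exists>y J. jacobi_field G br \<iota> M u0 \<gamma> y J \<and> (\<exists>t. J t \<noteq> zero_tangent) \<and>
        J 0 = zero_tangent \<and> J \<tau> = zero_tangent \<and> vector_derivative y (at 0) \<in> W)"

text \<open>Pitfall: stability on \<open>V\<close> constrains every solution starting in \<open>V\<close>, whereas a conjugate point
  needs only one Jacobi field. On a product of two copies of \<open>SL(2, R)\<close> with a product metric and
  \<open>u0 = (h, h)\<close>, the eigenspace \<open>V\<close> is four-dimensional and one factor can be stable (hence carry a
  conjugate point) while the other is unstable. So a conjugate point arising from \<open>V\<close> can only be
  expected to imply stability on \<open>V\<close> when \<open>V\<close> is a single pair of root spaces, i.e. \<open>dim V = 2\<close>.\<close>

definition eulerian_stable ::
  "('a::euclidean_space \<Rightarrow> 'a \<Rightarrow> 'a) \<Rightarrow> ('a \<Rightarrow> 'a \<Rightarrow> real) \<Rightarrow> 'a \<Rightarrow> 'a set \<Rightarrow> bool" where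
  "eulerian_stable br ip u0 V \<longleftrightarrow>
     (\<forall>z. linearized_euler_solution br ip u0 z \<and> z 0 \<in> V \<longrightarrow> bounded (range z))"

end

theory Submission
  imports Defs
begin

text \<open>Let \<open>L = ad u\<^sub>0\<close> and \<open>P = ad (\<Lambda> u\<^sub>0)\<close>. Both preserve \<open>V\<close>, and \<open>P\<close> is injective there: two commuting regular
  elements, one of them semisimple, have the same centralizer. Put \<open>T = \<Lambda>\<^sup>-\<^sup>1 P\<close> and \<open>A = T - L\<close>. On \<open>V\<close> the
  linearized Euler equation is conjugate to \<open>n' = A n\<close>, and a conjugate point at time \<open>\<tau>\<close> is a nonzero
  \<open>n \<in> V\<close> with \<open>exp (\<tau> A) n = exp (- \<tau> L) n\<close>. Both \<open>A\<close> and \<open>L\<close> are Hamiltonian for the symplectic form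
  \<open>\<omega> x y = \<kappa> (P x) y\<close>, and \<open>\<omega> x ((A + L) x) = \<langle>T x, T x\<rangle>\<close> is positive definite. If one of the two flows is
  bounded, then in its moving frame the relative flow twists at a rate bounded from below, so the
  Cayley transform of \<open>exp (t A) exp (t L)\<close> satisfies a Riccati inequality; it must therefore cease to
  exist in finite time, and this happens at a fixed vector. In case (i) the flow of \<open>L\<close> is bounded; in case (ii) stability says that
  the flow of \<open>A\<close> is. If \<open>dim V = 2\<close> and \<open>L\<close> is hyperbolic, then a flow of \<open>A\<close> that is hyperbolic or
  parabolic turns too little to meet that of \<open>- L\<close> again, so a conjugate point forces \<open>A\<^sup>2 < 0\<close>.\<close>

section \<open>The Banach algebra of endomorphisms\<close>

text \<open>A type of its own, so that composition can be its multiplication and \<open>exp\<close>,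
  with its calculus in Banach algebras, applies to endomorphisms.\<close>

typedef (overloaded) 'a endo = "UNIV :: ('a::euclidean_space \<Rightarrow>\<^sub>L 'a) set"
  morphisms blinfun_of_endo Endo ..

setup_lifting type_definition_endo

lift_definition endo_apply :: "'a::euclidean_space endo \<Rightarrow> 'a \<Rightarrow> 'a" is blinfun_apply .

text \<open>Meaningful for linear arguments only, where \<open>endo_apply\<close> undoes it.\<close>

lift_definition endo_of :: "('a::euclidean_space \<Rightarrow> 'a) \<Rightarrow> 'a endo" is Blinfun .

lemma endo_apply_endo_of: "linear f \<Longrightarrow> endo_apply (endo_of f) = f"
  by transfer (simp add: bounded_linear_Blinfun_apply linear_conv_bounded_linear)

instantiation endo :: (euclidean_space) real_normed_vector
begin

lift_definition zero_endo :: "'a endo" is 0 .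
lift_definition plus_endo :: "'a endo \<Rightarrow> 'a endo \<Rightarrow> 'a endo" is "(+)" .
lift_definition minus_endo :: "'a endo \<Rightarrow> 'a endo \<Rightarrow> 'a endo" is "(-)" .
lift_definition uminus_endo :: "'a endo \<Rightarrow> 'a endo" is uminus .
lift_definition scaleR_endo :: "real \<Rightarrow> 'a endo \<Rightarrow> 'a endo" is scaleR .
lift_definition norm_endo :: "'a endo \<Rightarrow> real" is norm .
lift_definition dist_endo :: "'a endo \<Rightarrow> 'a endo \<Rightarrow> real" is dist .
lift_definition sgn_endo :: "'a endo \<Rightarrow> 'a endo" is sgn .
definition uniformity_endo :: "('a endo \<times> 'a endo) filter" where
  "uniformity_endo = (INF e\<in>{0<..}. principal {(x, y). dist x y < e})"
definition open_endo :: "'a endo set \<Rightarrow> bool" where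
  "open_endo U = (\<forall>x\<in>U. \<forall>\<^sub>F (x', y) in uniformity. x' = x \<longrightarrow> y \<in> U)"

instance
proof
  fix A B C :: "'a endo" and r s :: real
  show "A + B + C = A + (B + C)" "A + B = B + A" "0 + A = A" "- A + A = 0" "A - B = A + - B"
    by (transfer; simp)+
  show "r *\<^sub>R (A + B) = r *\<^sub>R A + r *\<^sub>R B" "(r + s) *\<^sub>R A = r *\<^sub>R A + s *\<^sub>R A"
    "r *\<^sub>R s *\<^sub>R A = (r * s) *\<^sub>R A" "1 *\<^sub>R A = A"
    by (transfer; simp add: algebra_simps)+
  show "dist A B = norm (A - B)"
    by transfer (rule dist_norm)
  show "sgn A = inverse (norm A) *\<^sub>R A"
    by transfer (rule sgn_div_norm)
  show "(norm A = 0) = (A = 0)" "norm (r *\<^sub>R A) = \<bar>r\<bar> * norm A"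
    by (transfer; simp)+
  show "norm (A + B) \<le> norm A + norm B"
    by transfer (rule norm_triangle_ineq)
  show "uniformity = (INF e\<in>{0<..}. principal {(x::'a endo, y). dist x y < e})"
    by (rule uniformity_endo_def)
  show "open U = (\<forall>x\<in>U. \<forall>\<^sub>F (x', y) in uniformity. x' = x \<longrightarrow> y \<in> U)" for U :: "'a endo set"
    by (rule open_endo_def)
qed

end

text \<open>Completeness, on which the exponential series relies, is carried over along the isometry
  \<open>blinfun_of_endo\<close>.\<close>

instance endo :: (euclidean_space) banach
proof
  fix X :: "nat \<Rightarrow> 'a endo"
  have dist_eq: "dist A B = dist (blinfun_of_endo A) (blinfun_of_endo B)" for A B :: "'a endo"
    by transfer simp
  assume "Cauchy X"
  then have "Cauchy (\<lambda>n. blinfun_of_endo (X n))"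
    by (simp add: Cauchy_def dist_eq)
  then obtain K where K: "(\<lambda>n. blinfun_of_endo (X n)) \<longlonglongrightarrow> K"
    by (auto simp: Cauchy_convergent_iff convergent_def)
  have "X \<longlonglongrightarrow> Endo K"
    using K by (simp add: tendsto_iff dist_eq Endo_inverse)
  then show "convergent X"
    by (auto simp: convergent_def)
qed

instantiation endo :: (euclidean_space) real_normed_algebra_1
begin

lift_definition one_endo :: "'a endo" is id_blinfun .
lift_definition times_endo :: "'a endo \<Rightarrow> 'a endo \<Rightarrow> 'a endo" is "(o\<^sub>L)" .

instance
proof
  fix A B C :: "'a endo" and r :: real
  show "A * B * C = A * (B * C)" "1 * A = A" "A * 1 = A"
    by (transfer; rule blinfun_eqI; simp)+
  show "(A + B) * C = A * C + B * C" "A * (B + C) = A * B + A * C"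
    by (transfer; rule blinfun_eqI; simp add: blinfun.bilinear_simps)+
  show "r *\<^sub>R A * B = r *\<^sub>R (A * B)" "A * r *\<^sub>R B = r *\<^sub>R (A * B)"
    by (transfer; rule blinfun_eqI; simp add: blinfun.bilinear_simps)+
  show one: "norm (1 :: 'a endo) = 1"
    by transfer simp
  show "(0 :: 'a endo) \<noteq> 1"
    using one by (metis norm_zero zero_neq_one)
  show "norm (A * B) \<le> norm A * norm B"
    by transfer (rule norm_blinfun_compose)
qed

end

lemma norm_endo_apply: "norm (endo_apply A x) \<le> norm A * norm x"
  by transfer (rule norm_blinfun)

lemma bounded_bilinear_endo_apply: "bounded_bilinear endo_apply"
proof
  show "\<exists>K. \<forall>A x. norm (endo_apply A x :: 'a) \<le> norm A * norm x * K"
    by (rule exI[of _ 1]) (simp add: norm_endo_apply)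
qed (transfer; simp add: blinfun.bilinear_simps)+

interpretation endo: bounded_bilinear endo_apply
  by (rule bounded_bilinear_endo_apply)

lemma endo_apply_times [simp]: "endo_apply (A * B) x = endo_apply A (endo_apply B x)"
  by transfer simp

lemma endo_apply_one [simp]: "endo_apply 1 x = x"
  by transfer simp

lemma linear_endo_apply: "linear (endo_apply A)"
  using endo.bounded_linear_right bounded_linear.linear by blast

section \<open>Linear flows: invariant subspaces, uniqueness, preserved forms\<close>

lemma endo_apply_power_in:
  assumes "\<And>x. x \<in> V \<Longrightarrow> endo_apply A x \<in> V" "x \<in> V"
  shows "endo_apply (A ^ n) x \<in> V"
  by (induction n) (use assms in auto)

text \<open>The partial sums of the exponential series applied to \<open>x\<close> stay in
  \<open>V\<close>, and a subspace of a Euclidean space is closed.\<close>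

lemma endo_apply_exp_in:
  assumes "subspace V" "\<And>x. x \<in> V \<Longrightarrow> endo_apply A x \<in> V" "x \<in> V"
  shows "endo_apply (exp (t *\<^sub>R A)) x \<in> V"
proof -
  have "(\<lambda>n. (t *\<^sub>R A) ^ n /\<^sub>R fact n) sums exp (t *\<^sub>R A)"
    by (rule exp_converges)
  then have "(\<lambda>n. \<Sum>i<n. endo_apply ((t *\<^sub>R A) ^ i /\<^sub>R fact i) x) \<longlonglongrightarrow> endo_apply (exp (t *\<^sub>R A)) x"
    using bounded_linear.sums[OF endo.bounded_linear_left] by (simp add: sums_def)
  moreover have "(\<Sum>i<n. endo_apply ((t *\<^sub>R A) ^ i /\<^sub>R fact i) x) \<in> V" for n
    using assms(1,3)
    by (intro subspace_sum) (auto simp: endo.scaleR_left intro!: subspace_scale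
          endo_apply_power_in assms)
  ultimately show ?thesis
    by (rule closed_sequentially[OF closed_subspace[OF assms(1)], rotated])
qed

lemma exp_scaleR_neg_endo [simp]:
  "endo_apply (exp (- (t *\<^sub>R A))) (endo_apply (exp (t *\<^sub>R A)) x) = x"
  "endo_apply (exp (t *\<^sub>R A)) (endo_apply (exp (- (t *\<^sub>R A))) x) = x"
  by (metis endo_apply_one endo_apply_times exp_minus_inverse minus_minus)+

lemma exp_endo_has_vector_derivative:
  "((\<lambda>t. endo_apply (exp (t *\<^sub>R A)) x) has_vector_derivative
      endo_apply A (endo_apply (exp (t *\<^sub>R A)) x)) (at t)"
  using bounded_linear.has_vector_derivative[OF endo.bounded_linear_left
      exp_scaleR_has_vector_derivative_left] by fastforce

text \<open>The integrating factor \<open>exp (- (s *\<^sub>R A))\<close> turns \<open>z\<close>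
  into a constant.\<close>

lemma linear_ode_unique:
  assumes "\<And>t. (z has_vector_derivative endo_apply A (z t)) (at t)"
  shows "z t = endo_apply (exp (t *\<^sub>R A)) (z 0)"
proof -
  have neg: "((\<lambda>s. exp (- (s *\<^sub>R A))) has_vector_derivative - (exp (- (s *\<^sub>R A)) * A)) (at s)" for s
    using exp_scaleR_has_vector_derivative_right[of "- A" s] by simp
  have "((\<lambda>s. endo_apply (exp (- (s *\<^sub>R A))) (z s)) has_vector_derivative 0) (at s)" for s
    using endo.has_vector_derivative[OF neg[of s] assms[of s]]
    by (simp add: endo.minus_left)
  then obtain c where c: "\<And>s. endo_apply (exp (- (s *\<^sub>R A))) (z s) = c"
    using has_vector_derivative_zero_constant[of UNIV "\<lambda>s. endo_apply (exp (- (s *\<^sub>R A))) (z s)"]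
    by (auto simp: has_vector_derivative_at_within)
  from c[of 0] c[of t] show ?thesis
    by (metis endo_apply_one exp_scaleR_neg_endo(2) exp_zero minus_zero scaleR_zero_left)
qed

text \<open>Skewness of \<open>A\<close> makes the derivative of the pairing along the flow
  vanish.\<close>

lemma exp_preserves_skew_form:
  fixes \<omega> :: "'a::euclidean_space \<Rightarrow> 'a \<Rightarrow> real"
  assumes \<omega>: "bilinear \<omega>" and V: "subspace V" "\<And>x. x \<in> V \<Longrightarrow> endo_apply A x \<in> V"
    and skew: "\<And>x y. x \<in> V \<Longrightarrow> y \<in> V \<Longrightarrow> \<omega> (endo_apply A x) y = - \<omega> x (endo_apply A y)"
    and xy: "x \<in> V" "y \<in> V"
  shows "\<omega> (endo_apply (exp (t *\<^sub>R A)) x) (endo_apply (exp (t *\<^sub>R A)) y) = \<omega> x y"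
proof -
  interpret \<omega>: bounded_bilinear \<omega>
    using \<omega> bilinear_conv_bounded_bilinear by blast
  let ?f = "\<lambda>t. \<omega> (endo_apply (exp (t *\<^sub>R A)) x) (endo_apply (exp (t *\<^sub>R A)) y)"
  have "(?f has_vector_derivative 0) (at s)" for s
    using \<omega>.has_vector_derivative[OF exp_endo_has_vector_derivative[of A x s]
        exp_endo_has_vector_derivative[of A y s]]
      skew[of "endo_apply (exp (s *\<^sub>R A)) x" "endo_apply (exp (s *\<^sub>R A)) y"]
      endo_apply_exp_in[OF V] xy by simp
  then obtain c where "\<And>s. ?f s = c"
    using has_vector_derivative_zero_constant[of UNIV ?f]
    by (auto simp: has_vector_derivative_at_within)
  from this[of t] this[of 0] show ?thesis by simp
qed

section \<open>Fixed vectors of products of Hamiltonian flows\<close>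

lemma has_vector_derivative_iff_slope:
  "(f has_vector_derivative f') (at t) \<longleftrightarrow> ((\<lambda>s. (f s - f t) /\<^sub>R (s - t)) \<longlongrightarrow> f') (at t)"
proof -
  have "norm (f s - f t - (s - t) *\<^sub>R f') / norm (s - t) = norm ((f s - f t) /\<^sub>R (s - t) - f')"
    if "s \<noteq> t" for s
  proof -
    have "f s - f t - (s - t) *\<^sub>R f' = (s - t) *\<^sub>R ((f s - f t) /\<^sub>R (s - t)) - (s - t) *\<^sub>R f'"
      using that by simp
    also have "\<dots> = (s - t) *\<^sub>R ((f s - f t) /\<^sub>R (s - t) - f')"
      by (rule scaleR_diff_right[symmetric])
    finally show ?thesis
      using that by (simp only: norm_scaleR) simp
  qed
  then have "\<forall>\<^sub>F s in at t. norm (f s - f t - (s - t) *\<^sub>R f') / norm (s - t) =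
      norm ((f s - f t) /\<^sub>R (s - t) - f')"
    unfolding eventually_at_filter by (intro always_eventually) blast
  then have "((\<lambda>s. norm (f s - f t - (s - t) *\<^sub>R f') / norm (s - t)) \<longlongrightarrow> 0) (at t) \<longleftrightarrow>
      ((\<lambda>s. norm ((f s - f t) /\<^sub>R (s - t) - f')) \<longlongrightarrow> 0) (at t)"
    by (rule tendsto_cong)
  then show ?thesis
    unfolding has_vector_derivative_def has_derivative_iff_norm
    by (simp add: bounded_linear_scaleR_left tendsto_norm_zero_iff LIM_zero_iff)
qed

lemma endo_inj_on:
  assumes "subspace V" and inj: "\<And>x. x \<in> V \<Longrightarrow> endo_apply D x = 0 \<Longrightarrow> x = 0"
  shows "inj_on (endo_apply D) V"
proof (rule inj_onI)
  fix x y assume "x \<in> V" "y \<in> V" "endo_apply D x = endo_apply D y"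
  then have "x - y = 0"
    by - (rule inj; simp add: subspace_diff[OF assms(1)] endo.diff_right)
  then show "x = y" by simp
qed

text \<open>Implicit differentiation of \<open>D s (a s) = b\<close>. With a left inverse
  \<open>E\<close> of \<open>D t\<close> on \<open>V\<close>, the increment of \<open>a\<close> is
  \<open>- E (D s - D t) (a s)\<close>; this gives first continuity of \<open>a\<close> at
  \<open>t\<close>, then the limit of the difference quotient.\<close>

lemma solution_has_vector_derivative:
  fixes D :: "real \<Rightarrow> 'a::euclidean_space endo"
  assumes D: "(D has_vector_derivative D') (at t)"
    and V: "subspace V" and inj: "\<And>x. x \<in> V \<Longrightarrow> endo_apply (D t) x = 0 \<Longrightarrow> x = 0"
    and S: "open S" "t \<in> S" and a: "\<And>s. s \<in> S \<Longrightarrow> a s \<in> V \<and> endo_apply (D s) (a s) = b"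
    and c: "c \<in> V" "endo_apply (D t) c = - endo_apply D' (a t)"
  shows "(a has_vector_derivative c) (at t)"
proof -
  have "inj_on (endo_apply (D t)) V"
    by (rule endo_inj_on[OF V inj])
  then obtain g where g: "linear g" "\<And>v. v \<in> V \<Longrightarrow> g (endo_apply (D t) v) = v"
    using linear_exists_left_inverse_on[OF linear_endo_apply V] by metis
  define E where "E = endo_of g"
  have E: "endo_apply E (endo_apply (D t) v) = v" if "v \<in> V" for v
    using g that by (simp add: E_def endo_apply_endo_of)
  have diff: "a s - a t = - endo_apply (E * (D s - D t)) (a s)" if "s \<in> S" for s
  proof -
    have "a s - a t = endo_apply E (endo_apply (D t) (a s - a t))"
      using a S that V by (simp add: E subspace_diff)
    also have "endo_apply (D t) (a s - a t) = - endo_apply (D s - D t) (a s)"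
      using a that S by (simp add: endo.diff_left endo.diff_right)
    finally show ?thesis
      by (simp add: endo.minus_right)
  qed
  have evS: "\<forall>\<^sub>F s in at t. s \<in> S"
    using S by (rule eventually_at_in_open')
  have "(D \<longlongrightarrow> D t) (at t)"
    using has_vector_derivative_continuous[OF D] by (simp add: continuous_at)
  then have "((\<lambda>s. norm (E * (D s - D t))) \<longlongrightarrow> norm (E * (D t - D t))) (at t)"
    by (intro tendsto_intros)
  then have Eta: "((\<lambda>s. norm (E * (D s - D t))) \<longlongrightarrow> 0) (at t)"
    by simp
  \<comment> \<open>Once \<open>norm (E * (D s - D t))\<close> is below \<open>1/2\<close>, the
    increment formula bounds \<open>norm (a s)\<close> by \<open>2 * norm (a t)\<close>; inserting
    this bound into the formula makes the increment tend to 0.\<close>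
  have lim: "(a \<longlongrightarrow> a t) (at t)"
  proof -
    have "\<forall>\<^sub>F s in at t. norm (E * (D s - D t)) < 1/2"
      using order_tendstoD(2)[OF Eta, of "1/2"] by simp
    then have "\<forall>\<^sub>F s in at t. norm (a s - a t) \<le> norm (E * (D s - D t)) * (2 * norm (a t))"
      using evS
    proof eventually_elim
      case (elim s)
      let ?e = "norm (E * (D s - D t))"
      have "norm (endo_apply (E * (D s - D t)) (a s)) \<le> ?e * norm (a s)"
        by (rule norm_endo_apply)
      then have 1: "norm (a s - a t) \<le> ?e * norm (a s)"
        using diff[OF elim(2)] by simp
      moreover have "?e * norm (a s) \<le> 1/2 * norm (a s)"
        using elim(1) by (intro mult_right_mono) auto
      moreover have "norm (a s) \<le> norm (a t) + norm (a s - a t)"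
        by (metis norm_triangle_sub)
      ultimately have "norm (a s) \<le> 2 * norm (a t)"
        by linarith
      then have "?e * norm (a s) \<le> ?e * (2 * norm (a t))"
        by (intro mult_left_mono) auto
      with 1 show ?case by linarith
    qed
    moreover have "((\<lambda>s. norm (E * (D s - D t)) * (2 * norm (a t))) \<longlongrightarrow> 0) (at t)"
      using tendsto_mult_right[OF Eta, of "2 * norm (a t)"] by (simp add: mult.commute)
    ultimately have "((\<lambda>s. a s - a t) \<longlongrightarrow> 0) (at t)"
      by (rule Lim_null_comparison)
    then show ?thesis
      by (simp add: LIM_zero_iff)
  qed
  have "((\<lambda>s. - endo_apply E (endo_apply ((D s - D t) /\<^sub>R (s - t)) (a s))) \<longlongrightarrow>
      - endo_apply E (endo_apply D' (a t))) (at t)"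
    using D unfolding has_vector_derivative_iff_slope
    by (intro tendsto_minus endo.tendsto tendsto_const lim)
  moreover have "\<forall>\<^sub>F s in at t. - endo_apply E (endo_apply ((D s - D t) /\<^sub>R (s - t)) (a s)) =
      (a s - a t) /\<^sub>R (s - t)"
    using evS by eventually_elim (simp add: diff endo.scaleR_left endo.scaleR_right)
  ultimately have "((\<lambda>s. (a s - a t) /\<^sub>R (s - t)) \<longlongrightarrow> - endo_apply E (endo_apply D' (a t))) (at t)"
    by (rule Lim_transform_eventually)
  moreover have "- endo_apply E (endo_apply D' (a t)) = c"
    using c(2) E[OF c(1)] by (simp add: endo.minus_right)
  ultimately show ?thesis
    by (simp add: has_vector_derivative_iff_slope)
qed

text \<open>The constant bound makes \<open>r\<close> negative; from then on \<open>1 / r\<close>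
  grows at rate at least \<open>d\<close> and would reach 0 in finite time.\<close>

lemma no_global_riccati_solution:
  fixes r :: "real \<Rightarrow> real"
  assumes der: "\<And>t. t > 0 \<Longrightarrow> (r has_real_derivative r' t) (at t)"
    and d: "d > 0" "\<And>t. t > 0 \<Longrightarrow> r' t \<le> - d" "\<And>t. t > 0 \<Longrightarrow> r' t \<le> - d * (r t)\<^sup>2"
  shows False
proof -
  have r_le: "r t \<le> r 1 - d * (t - 1)" if "t \<ge> 1" for t
  proof -
    have "r t + d * t \<le> r 1 + d * 1"
    proof (rule DERIV_nonpos_imp_nonincreasing[OF that, where f = "\<lambda>t. r t + d * t"])
      fix x :: real assume "1 \<le> x"
      then show "\<exists>y. ((\<lambda>t. r t + d * t) has_real_derivative y) (at x) \<and> y \<le> 0"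
        using d(2)[of x]
        by (intro exI[of _ "r' x + d"]) (auto intro!: derivative_eq_intros der)
    qed
    then show ?thesis by (simp add: algebra_simps)
  qed
  \<comment> \<open>Chosen so that \<open>r_le\<close> yields
    \<open>r t1 \<le> r 1 - \<bar>r 1\<bar> - 1 < 0\<close>.\<close>
  define t1 where "t1 = 1 + (\<bar>r 1\<bar> + 1) / d"
  have t1: "t1 \<ge> 1"
    using d(1) by (simp add: t1_def)
  have neg: "r t < 0" if "t \<ge> t1" for t
  proof -
    have "d * (t - 1) \<ge> d * (t1 - 1)"
      using that d(1) by simp
    also have "d * (t1 - 1) = \<bar>r 1\<bar> + 1"
      using d(1) by (simp add: t1_def)
    finally show ?thesis
      using r_le[of t] t1 that by linarith
  qed
  \<comment> \<open>The time at which the lower bound \<open>1 / r t1 + d * (t - t1)\<close> of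
    \<open>1 / r t\<close> reaches 0.\<close>
  define t2 where "t2 = t1 - 1 / (d * r t1)"
  have t2: "t2 > t1"
    using neg[of t1] d(1) by (simp add: t2_def field_simps zero_less_mult_iff mult_less_0_iff)
  have "d * t2 - 1 / r t2 \<le> d * t1 - 1 / r t1"
  proof (rule DERIV_nonpos_imp_nonincreasing[where f = "\<lambda>t. d * t - 1 / r t"])
    fix x :: real assume x: "t1 \<le> x"
    have "d + r' x / (r x)\<^sup>2 \<le> 0"
      using d(3)[of x] neg[OF x] x t1 by (simp add: field_simps)
    then show "\<exists>y. ((\<lambda>t. d * t - 1 / r t) has_real_derivative y) (at x) \<and> y \<le> 0"
      using x t1 neg[OF x]
      by (intro exI[of _ "d + r' x / (r x)\<^sup>2"])
         (auto intro!: derivative_eq_intros der simp: power2_eq_square)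
  qed (use t2 in auto)
  moreover have "d * t2 - d * t1 = - (1 / r t1)"
    using d(1) neg[of t1] by (simp add: t2_def field_simps)
  ultimately have "1 / r t2 \<ge> 0"
    by linarith
  then show False
    using neg[of t2] t2 by (simp add: zero_le_divide_1_iff)
qed

lemma endo_surj_on_subspace:
  assumes V: "subspace V" "\<And>x. x \<in> V \<Longrightarrow> endo_apply D x \<in> V"
    and inj: "\<And>x. x \<in> V \<Longrightarrow> endo_apply D x = 0 \<Longrightarrow> x = 0" and y: "y \<in> V"
  obtains x where "x \<in> V" "endo_apply D x = y"
proof -
  have "inj_on (endo_apply D) V"
    by (rule endo_inj_on[OF V(1) inj])
  then have "dim (endo_apply D ` V) = dim V"
    using dim_image_eq[OF linear_endo_apply, of D V] span_eq_iff[THEN iffD2, OF V(1)] by simp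
  moreover have "endo_apply D ` V \<subseteq> V"
    using V(2) by (rule image_subsetI)
  ultimately have "endo_apply D ` V = V"
    using subspace_dim_equal[OF linear_subspace_image[OF linear_endo_apply V(1)] V(1)] by simp
  with y have "y \<in> endo_apply D ` V"
    by simp
  then show ?thesis
    by (rule imageE) (rule that, simp_all)
qed

text \<open>Uniform boundedness in finite dimension: the bounds on an orthonormal basis of
  \<open>V\<close> are summed.\<close>

lemma pointwise_bounded_imp_uniformly_bounded:
  fixes f :: "'b \<Rightarrow> 'a::euclidean_space endo"
  assumes V: "subspace V" and bdd: "\<And>x. x \<in> V \<Longrightarrow> bounded (range (\<lambda>t. endo_apply (f t) x))"
  obtains C where "C > 0" "\<And>t x. x \<in> V \<Longrightarrow> norm (endo_apply (f t) x) \<le> C * norm x"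
proof -
  obtain B where B: "B \<subseteq> V" "pairwise orthogonal B" "\<And>x. x \<in> B \<Longrightarrow> norm x = 1" "independent B" "span B = V"
    using orthonormal_basis_subspace[OF V] by metis
  have fin: "finite B"
    using B(4) independent_imp_finite by blast
  have "\<exists>K. \<forall>t. norm (endo_apply (f t) b) \<le> K" if "b \<in> B" for b
    using bdd[of b] that B(1) by (auto simp: bounded_iff)
  then obtain K where K: "\<And>b t. b \<in> B \<Longrightarrow> norm (endo_apply (f t) b) \<le> K b"
    by metis
  have "norm (endo_apply (f t) x) \<le> (1 + (\<Sum>b\<in>B. \<bar>K b\<bar>)) * norm x" if x: "x \<in> V" for t x
  proof -
    have "x = (\<Sum>b\<in>B. (x \<bullet> b) *\<^sub>R b)"
      using orthonormal_basis_expand[of B x] B fin x by simp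
    then have "endo_apply (f t) x = (\<Sum>b\<in>B. (x \<bullet> b) *\<^sub>R endo_apply (f t) b)"
      by (metis (no_types, lifting) endo.scaleR_right endo.sum_right sum.cong)
    also have "norm \<dots> \<le> (\<Sum>b\<in>B. norm ((x \<bullet> b) *\<^sub>R endo_apply (f t) b))"
      by (rule norm_sum)
    also have "\<dots> \<le> (\<Sum>b\<in>B. norm x * \<bar>K b\<bar>)"
    proof (rule sum_mono)
      fix b assume b: "b \<in> B"
      have "\<bar>x \<bullet> b\<bar> \<le> norm x"
        using Cauchy_Schwarz_ineq2[of x b] B(3)[OF b] by simp
      then show "norm ((x \<bullet> b) *\<^sub>R endo_apply (f t) b) \<le> norm x * \<bar>K b\<bar>"
        using K[OF b, of t] by (auto intro!: mult_mono)
    qed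
    also have "\<dots> \<le> (1 + (\<Sum>b\<in>B. \<bar>K b\<bar>)) * norm x"
      by (simp add: sum_distrib_left[symmetric] algebra_simps)
    finally show ?thesis .
  qed
  \<comment> \<open>The summand 1 keeps the constant positive even when the sum is 0.\<close>
  moreover have "1 + (\<Sum>b\<in>B. \<bar>K b\<bar>) > 0"
    by (smt (verit) sum_nonneg abs_ge_zero)
  ultimately show ?thesis
    using that by blast
qed

text \<open>\<open>A\<close> and \<open>B\<close> are infinitesimally symplectic on
  \<open>V\<close>; \<open>pos\<close> makes \<omega> nondegenerate there, since \<open>x\<close>
  pairs nontrivially with \<open>(A + B) x\<close>. The conditions are symmetric in \<open>A\<close>
  and \<open>B\<close>, so results about the flow of \<open>A\<close> apply to either
  operator.\<close>

locale skew_pair =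
  fixes V :: "'a::euclidean_space set" and \<omega> :: "'a \<Rightarrow> 'a \<Rightarrow> real" and A B :: "'a endo"
  assumes V: "subspace V"
    and bilinear_\<omega>: "bilinear \<omega>"
    and antisym: "x \<in> V \<Longrightarrow> y \<in> V \<Longrightarrow> \<omega> x y = - \<omega> y x"
    and A_in: "x \<in> V \<Longrightarrow> endo_apply A x \<in> V"
    and B_in: "x \<in> V \<Longrightarrow> endo_apply B x \<in> V"
    and A_skew: "x \<in> V \<Longrightarrow> y \<in> V \<Longrightarrow> \<omega> (endo_apply A x) y = - \<omega> x (endo_apply A y)"
    and B_skew: "x \<in> V \<Longrightarrow> y \<in> V \<Longrightarrow> \<omega> (endo_apply B x) y = - \<omega> x (endo_apply B y)"
    and pos: "x \<in> V \<Longrightarrow> x \<noteq> 0 \<Longrightarrow> \<omega> x (endo_apply (A + B) x) > 0"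
begin

lemma bounded_bilinear_\<omega>: "bounded_bilinear \<omega>"
  using bilinear_\<omega> bilinear_conv_bounded_bilinear by blast

sublocale \<omega>: bounded_bilinear \<omega>
  by (rule bounded_bilinear_\<omega>)

lemma expA_in: "x \<in> V \<Longrightarrow> endo_apply (exp (t *\<^sub>R A)) x \<in> V"
  and expB_in: "x \<in> V \<Longrightarrow> endo_apply (exp (t *\<^sub>R B)) x \<in> V"
  using endo_apply_exp_in V A_in B_in by blast+

lemma \<omega>_expA: "x \<in> V \<Longrightarrow> y \<in> V \<Longrightarrow>
    \<omega> (endo_apply (exp (t *\<^sub>R A)) x) (endo_apply (exp (t *\<^sub>R A)) y) = \<omega> x y"
  and \<omega>_expB: "x \<in> V \<Longrightarrow> y \<in> V \<Longrightarrow>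
    \<omega> (endo_apply (exp (t *\<^sub>R B)) x) (endo_apply (exp (t *\<^sub>R B)) y) = \<omega> x y"
  using exp_preserves_skew_form[OF bilinear_\<omega> V] A_in B_in A_skew B_skew by blast+

lemma \<omega>_self: "x \<in> V \<Longrightarrow> \<omega> x x = 0"
  using antisym[of x x] by simp

text \<open>The minimum over the compact unit sphere of \<open>V\<close>, extended by homogeneity of
  degree two.\<close>

lemma uniformly_pos:
  obtains m where "m > 0" "\<And>x. x \<in> V \<Longrightarrow> \<omega> x (endo_apply (A + B) x) \<ge> m * (norm x)\<^sup>2"
proof (cases "V \<inter> sphere 0 1 = {}")
  case True
  have "x = 0" if "x \<in> V" for x
  proof (rule ccontr)
    assume "x \<noteq> 0"
    then have "x /\<^sub>R norm x \<in> V \<inter> sphere 0 1"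
      using that V by (simp add: subspace_scale)
    with True show False by blast
  qed
  then show ?thesis
    using that[of 1] by (force simp: \<omega>.zero_left)
next
  case False
  let ?q = "\<lambda>x. \<omega> x (endo_apply (A + B) x)"
  have "compact (V \<inter> sphere 0 1)"
    using closed_Int_compact[OF closed_subspace[OF V] compact_sphere] .
  moreover have "continuous_on (V \<inter> sphere 0 1) ?q"
    by (intro \<omega>.continuous_on endo.continuous_on continuous_intros)
  ultimately obtain x0 where x0: "x0 \<in> V \<inter> sphere 0 1" "\<And>x. x \<in> V \<inter> sphere 0 1 \<Longrightarrow> ?q x0 \<le> ?q x"
    using continuous_attains_inf[of "V \<inter> sphere 0 1" ?q] False by blast
  have "?q x \<ge> ?q x0 * (norm x)\<^sup>2" if x: "x \<in> V" for x
  proof (cases "x = 0")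
    case False
    then have "x /\<^sub>R norm x \<in> V \<inter> sphere 0 1"
      using x V by (simp add: subspace_scale)
    from x0(2)[OF this] have "?q x0 \<le> ?q x / (norm x)\<^sup>2"
      by (simp add: \<omega>.scaleR_left \<omega>.scaleR_right endo.scaleR_right power2_eq_square field_simps)
    then show ?thesis
      using False by (simp add: field_simps)
  qed (simp add: \<omega>.zero_left)
  moreover have "?q x0 > 0"
    using x0(1) by (intro pos) auto
  ultimately show ?thesis
    using that by blast
qed

text \<open>If \<open>N t = exp (t A) exp (t B)\<close> had no fixed vector for any \<open>t > 0\<close>, then for \<open>b \<in> V\<close> the
  solutions \<open>a t\<close> of \<open>N t (a t) - a t = b\<close> would make \<open>\<omega> (a t) b\<close> a decreasing function of \<open>t\<close>. Taking the
  sum over two vectors \<open>b\<close> that are not \<open>\<omega>\<close>-orthogonal gives a solution of a Riccati inequality for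
  all \<open>t > 0\<close>, which is impossible.\<close>

proposition bounded_flow_imp_fixed_vector:
  assumes "V \<noteq> {0}" and bdd: "\<And>x. x \<in> V \<Longrightarrow> bounded (range (\<lambda>t. endo_apply (exp (t *\<^sub>R A)) x))"
  obtains \<tau> x where "\<tau> > 0" "x \<in> V" "x \<noteq> 0"
    "endo_apply (exp (\<tau> *\<^sub>R A)) (endo_apply (exp (\<tau> *\<^sub>R B)) x) = x"
proof (rule ccontr)
  define N where "N t = exp (t *\<^sub>R A) * exp (t *\<^sub>R B)" for t
  have N_in: "endo_apply (N t) x \<in> V" if "x \<in> V" for t x
    using that by (simp add: N_def expA_in expB_in)
  have \<omega>_N: "\<omega> (endo_apply (N t) x) (endo_apply (N t) y) = \<omega> x y" if "x \<in> V" "y \<in> V" for t x y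
    using that by (simp add: N_def \<omega>_expA \<omega>_expB expB_in)
  \<comment> \<open>Product rule: \<open>A\<close> and \<open>B\<close> are both written between the
    two exponentials, each commuting with its own.\<close>
  define N' where "N' t = exp (t *\<^sub>R A) * (A + B) * exp (t *\<^sub>R B)" for t
  have N': "((\<lambda>t. N t - 1) has_vector_derivative N' t) (at t)" for t
    unfolding N_def N'_def
    by (rule derivative_eq_intros exp_scaleR_has_vector_derivative_right
        exp_scaleR_has_vector_derivative_left has_vector_derivative_mult refl)+
      (simp add: algebra_simps)
  assume "\<not> thesis"
  then have no_fix: "endo_apply (exp (t *\<^sub>R A)) (endo_apply (exp (t *\<^sub>R B)) x) \<noteq> x"
    if "t > 0" "x \<in> V" "x \<noteq> 0" for t x
    using that \<open>\<And>\<tau> x. \<lbrakk>\<tau> > 0; x \<in> V; x \<noteq> 0; _ \<tau> x\<rbrakk> \<Longrightarrow> thesis\<close> by blast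
  have inj: "x = 0" if "t > 0" "x \<in> V" "endo_apply (N t - 1) x = 0" for t x
    using no_fix[of t x] that by (auto simp: N_def endo.diff_left)
  have D_in: "endo_apply (N t - 1) x \<in> V" if "x \<in> V" for t x
    using that by (simp add: endo.diff_left subspace_diff[OF V] N_in)
  have surj: "\<exists>a\<in>V. endo_apply (N t - 1) a = b" if "t > 0" "b \<in> V" for t b
    by (rule endo_surj_on_subspace[OF V D_in inj[OF that(1)] that(2)]) auto
  obtain a where a: "\<And>t b. t > 0 \<Longrightarrow> b \<in> V \<Longrightarrow> a t b \<in> V \<and> endo_apply (N t - 1) (a t b) = b"
    using surj by metis
  define w where "w t b = a t b + b" for t b
  have w: "w t b = endo_apply (N t) (a t b)" "a t b \<in> V" if "t > 0" "b \<in> V" for t b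
    using a[OF that] by (auto simp: w_def endo.diff_left algebra_simps)
  \<comment> \<open>Halfway between \<open>a t b\<close> and \<open>w t b = N t (a t b)\<close>: the
    flow of \<open>A\<close> takes \<open>u t b\<close> to \<open>w t b\<close>.\<close>
  define u where "u t b = endo_apply (exp (t *\<^sub>R B)) (a t b)" for t b
  have u: "u t b \<in> V" if "t > 0" "b \<in> V" for t b
    using that by (simp add: u_def expB_in w)
  have der: "((\<lambda>t. \<omega> (a t b) b) has_real_derivative - \<omega> (u t b) (endo_apply (A + B) (u t b))) (at t)"
    if t: "t > 0" and b: "b \<in> V" for t b
  proof -
    have "endo_apply (N' t) (a t b) \<in> V"
      using w(2)[OF t b] by (simp add: N'_def endo.add_left subspace_add[OF V] A_in B_in expA_in expB_in)
    then obtain c where c: "c \<in> V" "endo_apply (N t - 1) c = - endo_apply (N' t) (a t b)"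
      using surj[OF t subspace_neg[OF V]] by blast
    have "((\<lambda>s. a s b) has_vector_derivative c) (at t)"
      by (rule solution_has_vector_derivative[where D = "\<lambda>t. N t - 1" and a = "\<lambda>s. a s b",
            OF N' V inj[OF t] open_greaterThan[of 0] _ _ c])
        (use t a b in auto)
    then have *: "((\<lambda>s. \<omega> (a s b) b) has_vector_derivative \<omega> c b) (at t)"
      by (rule bounded_linear.has_vector_derivative[OF \<omega>.bounded_linear_left])
    \<comment> \<open>Differentiating \<open>N a - a = b\<close> gives
      \<open>c - N c = N' a\<close>. Since \<open>N\<close> preserves \<omega>,
      \<open>\<omega> c a = \<omega> (N c) w\<close>; so
      \<open>\<omega> c b = \<omega> (N' a) w\<close>, which the flow of \<open>A\<close> pulls back
      to a pairing at \<open>u\<close>.\<close>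
    have "\<omega> c b = \<omega> c (w t b) - \<omega> c (a t b)"
      by (simp add: w_def \<omega>.add_right)
    also have "\<omega> c (a t b) = \<omega> (endo_apply (N t) c) (w t b)"
      using \<omega>_N c(1) w[OF t b] by simp
    also have "\<omega> c (w t b) - \<dots> = \<omega> (endo_apply (N' t) (a t b)) (w t b)"
      unfolding \<omega>.diff_left[symmetric]
      using c(2) by (simp add: endo.diff_left neg_eq_iff_add_eq_0 flip: minus_diff_eq[of _ c])
    also have "\<dots> = \<omega> (endo_apply (exp (t *\<^sub>R A)) (endo_apply (A + B) (u t b)))
        (endo_apply (exp (t *\<^sub>R A)) (u t b))"
      using w[OF t b] by (simp add: N'_def N_def u_def)
    also have "\<dots> = \<omega> (endo_apply (A + B) (u t b)) (u t b)"
      using u[OF t b] by (intro \<omega>_expA) (auto simp: endo.add_left intro!: subspace_add[OF V] A_in B_in)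
    also have "\<dots> = - \<omega> (u t b) (endo_apply (A + B) (u t b))"
      using u[OF t b] by (intro antisym) (auto simp: endo.add_left intro!: subspace_add[OF V] A_in B_in)
    finally show ?thesis
      using * by (simp add: has_real_derivative_iff_has_vector_derivative)
  qed
  obtain m where m: "m > 0" "\<And>x. x \<in> V \<Longrightarrow> \<omega> x (endo_apply (A + B) x) \<ge> m * (norm x)\<^sup>2"
    using uniformly_pos by blast
  obtain C where C: "C > 0" "\<And>t x. x \<in> V \<Longrightarrow> norm (endo_apply (exp (t *\<^sub>R A)) x) \<le> C * norm x"
    using pointwise_bounded_imp_uniformly_bounded[OF V bdd] by blast
  \<comment> \<open>As \<open>norm w \<le> C * norm u\<close>, the bound
    \<open>m * (norm u)\<^sup>2\<close> becomes one in terms of \<open>w\<close> at the cost of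
    \<open>C\<^sup>2\<close>.\<close>
  define \<epsilon> where "\<epsilon> = m / C\<^sup>2"
  have \<epsilon>: "\<epsilon> > 0"
    using m(1) C(1) by (simp add: \<epsilon>_def)
  have u_ge: "\<omega> (u t b) (endo_apply (A + B) (u t b)) \<ge> \<epsilon> * (norm (w t b))\<^sup>2" if "t > 0" "b \<in> V" for t b
  proof -
    have "norm (w t b) \<le> C * norm (u t b)"
      using C(2)[OF u[OF that], of t] w(1)[OF that] by (simp add: N_def u_def)
    then have "(norm (w t b))\<^sup>2 \<le> C\<^sup>2 * (norm (u t b))\<^sup>2"
      by (metis norm_ge_zero power_mono power_mult_distrib)
    then have "\<epsilon> * (norm (w t b))\<^sup>2 \<le> m * (norm (u t b))\<^sup>2"
      using m(1) C(1) by (simp add: \<epsilon>_def field_simps)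
    with m(2)[OF u[OF that]] show ?thesis by linarith
  qed
  obtain b1 where b1: "b1 \<in> V" "b1 \<noteq> 0"
    using \<open>V \<noteq> {0}\<close> V subspace_0 by blast
  \<comment> \<open>By \<open>pos\<close>, this choice makes \<open>\<omega> b1 b2\<close>
    positive.\<close>
  define b2 where "b2 = endo_apply (A + B) b1"
  have b2: "b2 \<in> V" "\<omega> b1 b2 > 0"
    using b1 pos by (auto simp: b2_def endo.add_left intro!: subspace_add[OF V] A_in B_in)
  obtain K where K: "K > 0" "\<And>x y. norm (\<omega> x y) \<le> norm x * norm y * K"
    using \<omega>.pos_bounded by blast
  define H where "H = K * (norm b1 + norm b2)"
  have H: "H > 0"
    using K b1 by (simp add: H_def add_pos_nonneg)
  have H_bound: "\<bar>\<omega> x b\<bar> \<le> H * norm x" if "b \<in> {b1, b2}" for x b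
  proof -
    have "\<bar>\<omega> x b\<bar> \<le> norm x * K * norm b"
      using K(2)[of x b] by (simp add: mult_ac)
    also have "\<dots> \<le> norm x * K * (norm b1 + norm b2)"
      using that K(1) by (intro mult_left_mono) auto
    finally show ?thesis
      by (simp add: H_def mult_ac)
  qed
  define Q where "Q t = (norm (w t b1))\<^sup>2 + (norm (w t b2))\<^sup>2" for t
  have sq: "x\<^sup>2 \<le> 2 * H\<^sup>2 * Q t" if "\<bar>x\<bar> \<le> H * norm (w t b1) + H * norm (w t b2)" for x t
  proof -
    have "x\<^sup>2 \<le> (H * norm (w t b1) + H * norm (w t b2))\<^sup>2"
      using that H by (metis abs_ge_zero power2_abs power_mono)
    also have "\<dots> = H\<^sup>2 * (norm (w t b1) + norm (w t b2))\<^sup>2"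
      by (simp add: power2_eq_square algebra_simps)
    also have "\<dots> \<le> H\<^sup>2 * (2 * Q t)"
      using sum_squares_bound[of "norm (w t b1)" "norm (w t b2)"]
      by (intro mult_left_mono) (auto simp: Q_def power2_sum)
    finally show ?thesis by simp
  qed
  define r where "r t = \<omega> (a t b1) b1 + \<omega> (a t b2) b2" for t
  define r' where "r' t = - \<omega> (u t b1) (endo_apply (A + B) (u t b1))
      - \<omega> (u t b2) (endo_apply (A + B) (u t b2))" for t
  \<comment> \<open>The first entry serves the quadratic Riccati bound, the second the constant
    one.\<close>
  define d where "d = min (\<epsilon> / (2 * H\<^sup>2)) (\<epsilon> / (2 * H\<^sup>2) * (\<omega> b1 b2)\<^sup>2)"
  have r'_le: "r' t \<le> - (\<epsilon> / (2 * H\<^sup>2)) * x\<^sup>2"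
    if "t > 0" "\<bar>x\<bar> \<le> H * norm (w t b1) + H * norm (w t b2)" for t x
  proof -
    have "r' t \<le> - (\<epsilon> * Q t)"
      using u_ge[OF that(1) b1(1)] u_ge[OF that(1) b2(1)] by (simp add: r'_def Q_def algebra_simps)
    moreover have "\<epsilon> / (2 * H\<^sup>2) * x\<^sup>2 \<le> \<epsilon> / (2 * H\<^sup>2) * (2 * H\<^sup>2 * Q t)"
      using \<epsilon> sq[OF that(2)] by (intro mult_left_mono) auto
    ultimately show ?thesis
      using H by simp
  qed
  show False
  proof (rule no_global_riccati_solution[of r r' d])
    show "d > 0"
      using \<epsilon> H b2(2) by (simp add: d_def)
  next
    fix t :: real assume t: "t > 0"
    show "(r has_real_derivative r' t) (at t)"
      unfolding r_def r'_def using DERIV_add[OF der[OF t b1(1)] der[OF t b2(1)]] by simp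
    have aw: "\<omega> (a t b) b = \<omega> (w t b) b" if "b \<in> V" for b
      using \<omega>_self[OF that] by (simp add: w_def \<omega>.add_left)
    have "\<bar>r t\<bar> \<le> H * norm (w t b1) + H * norm (w t b2)"
      using H_bound[of b1 "w t b1"] H_bound[of b2 "w t b2"] by (simp add: r_def aw b1 b2)
    then have "r' t \<le> - (\<epsilon> / (2 * H\<^sup>2)) * (r t)\<^sup>2"
      using r'_le[OF t] by blast
    moreover have "d * (r t)\<^sup>2 \<le> \<epsilon> / (2 * H\<^sup>2) * (r t)\<^sup>2"
      by (intro mult_right_mono) (auto simp: d_def)
    ultimately show "r' t \<le> - d * (r t)\<^sup>2"
      by simp
    \<comment> \<open>Expanding \<open>\<omega> (N x) (N y) = \<omega> x y\<close> shows that
      \<open>w t b1\<close> and \<open>w t b2\<close> cannot both be small, which keeps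
      \<open>r'\<close> away from 0. This is why two vectors are used.\<close>
    have "\<omega> (w t b1) b2 - \<omega> (w t b2) b1 = \<omega> b1 b2"
    proof -
      let ?x = "a t b1" and ?y = "a t b2"
      let ?Nx = "endo_apply (N t) ?x" and ?Ny = "endo_apply (N t) ?y"
      have x: "?x \<in> V" "?Nx \<in> V" "?Nx = ?x + b1" and y: "?y \<in> V" "?Ny \<in> V" "?Ny = ?y + b2"
        using w[OF t b1(1)] w[OF t b2(1)] by (auto simp: w_def N_in)
      have "\<omega> (?x + b1) (?y + b2) = \<omega> ?x ?y"
        using \<omega>_N[OF x(1) y(1), of t] x y by simp
      then have "\<omega> ?x b2 + \<omega> b1 ?y + \<omega> b1 b2 = 0"
        by (simp add: \<omega>.add_left \<omega>.add_right)
      then show ?thesis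
        using antisym[OF y(1) b1(1)] antisym[OF b2(1) b1(1)] by (simp add: w_def \<omega>.add_left)
    qed
    then have "\<bar>\<omega> b1 b2\<bar> \<le> H * norm (w t b1) + H * norm (w t b2)"
      using H_bound[of b2 "w t b1"] H_bound[of b1 "w t b2"] by simp
    then have "r' t \<le> - (\<epsilon> / (2 * H\<^sup>2)) * (\<omega> b1 b2)\<^sup>2"
      using r'_le[OF t] by blast
    then show "r' t \<le> - d"
      by (simp add: d_def min_def)
  qed
qed

end

section \<open>Two-dimensional Hamiltonian flows\<close>

text \<open>The solutions of \<open>x'' = k x\<close> with initial values \<open>(1, 0)\<close> and \<open>(0, 1)\<close>.\<close>

definition gcos :: "real \<Rightarrow> real \<Rightarrow> real" where
  "gcos k t = (if k > 0 then cosh (sqrt k * t) else if k < 0 then cos (sqrt (- k) * t) else 1)"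

definition gsin :: "real \<Rightarrow> real \<Rightarrow> real" where
  "gsin k t = (if k > 0 then sinh (sqrt k * t) / sqrt k
     else if k < 0 then sin (sqrt (- k) * t) / sqrt (- k) else t)"

lemma gcos_0 [simp]: "gcos k 0 = 1" and gsin_0 [simp]: "gsin k 0 = 0"
  by (auto simp: gcos_def gsin_def)

lemma gcos_gsin_cases:
  obtains (pos) r where "r > 0" "k = r\<^sup>2" "gcos k = (\<lambda>t. cosh (r * t))" "gsin k = (\<lambda>t. sinh (r * t) / r)"
  | (neg) r where "r > 0" "k = - r\<^sup>2" "gcos k = (\<lambda>t. cos (r * t))" "gsin k = (\<lambda>t. sin (r * t) / r)"
  | (zero) "k = 0" "gcos k = (\<lambda>t. 1)" "gsin k = (\<lambda>t. t)"
proof -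
  consider "k > 0" | "k < 0" | "k = 0" by linarith
  then show ?thesis
    by cases (use pos[of "sqrt k"] neg[of "sqrt (- k)"] zero in \<open>auto simp: gcos_def gsin_def fun_eq_iff\<close>)
qed

lemma has_real_derivative_gcos: "(gcos k has_real_derivative k * gsin k t) (at t)"
  by (cases k rule: gcos_gsin_cases) (auto intro!: derivative_eq_intros simp: power2_eq_square)

lemma has_real_derivative_gsin: "(gsin k has_real_derivative gcos k t) (at t)"
  by (cases k rule: gcos_gsin_cases) (auto intro!: derivative_eq_intros)

lemma gcos_square: "(gcos k t)\<^sup>2 = 1 + k * (gsin k t)\<^sup>2"
  by (cases k rule: gcos_gsin_cases) (simp_all add: cosh_square_eq cos_squared_eq power_divide)

lemma gcos_pos: "k \<ge> 0 \<Longrightarrow> gcos k t > 0"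
  by (auto simp: gcos_def)

lemma gsin_pos: "k \<ge> 0 \<Longrightarrow> t > 0 \<Longrightarrow> gsin k t > 0"
  by (auto simp: gsin_def)

text \<open>The right-hand side solves the linear equation of \<open>A\<close> with initial value
  \<open>x\<close>.\<close>

lemma exp_endo_eq_gcos_gsin:
  assumes "endo_apply A (endo_apply A x) = k *\<^sub>R x"
  shows "endo_apply (exp (t *\<^sub>R A)) x = gcos k t *\<^sub>R x + gsin k t *\<^sub>R endo_apply A x"
proof -
  have "((\<lambda>t. gcos k t *\<^sub>R x + gsin k t *\<^sub>R endo_apply A x) has_vector_derivative
      endo_apply A (gcos k t *\<^sub>R x + gsin k t *\<^sub>R endo_apply A x)) (at t)" for t
    using assms
    by (auto simp: endo.add_right endo.scaleR_right mult.commute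
        intro!: derivative_eq_intros has_real_derivative_gcos has_real_derivative_gsin)
  from linear_ode_unique[OF this, of t] show ?thesis
    by simp
qed

lemma bounded_exp_endo_negative_square:
  assumes "endo_apply A (endo_apply A x) = k *\<^sub>R x" "k < 0"
  shows "bounded (range (\<lambda>t. endo_apply (exp (t *\<^sub>R A)) x))"
proof -
  have "norm (endo_apply (exp (t *\<^sub>R A)) x) \<le> norm x + 1 / sqrt (- k) * norm (endo_apply A x)" for t
  proof -
    have "norm (endo_apply (exp (t *\<^sub>R A)) x) \<le> \<bar>gcos k t\<bar> * norm x + \<bar>gsin k t\<bar> * norm (endo_apply A x)"
      unfolding exp_endo_eq_gcos_gsin[OF assms(1)] by (metis norm_scaleR norm_triangle_ineq)
    also have "\<dots> \<le> 1 * norm x + 1 / sqrt (- k) * norm (endo_apply A x)"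
      using assms(2) by (intro add_mono mult_right_mono)
        (auto simp: gcos_def gsin_def divide_simps)
    finally show ?thesis by simp
  qed
  then show ?thesis
    by (auto simp: bounded_iff)
qed

lemma exp_endo_eigenvector:
  assumes "endo_apply A x = c *\<^sub>R x"
  shows "endo_apply (exp (t *\<^sub>R A)) x = exp (c * t) *\<^sub>R x"
proof -
  have "((\<lambda>t. exp (c * t) *\<^sub>R x) has_vector_derivative endo_apply A (exp (c * t) *\<^sub>R x)) (at t)" for t
    using assms
    by (auto simp: endo.scaleR_right mult.commute intro!: derivative_eq_intros)
  from linear_ode_unique[OF this, of t] show ?thesis
    by simp
qed

text \<open>The left-hand side equals \<open>1\<close> at \<open>t = 0\<close>; its derivative is seen to be negative by comparing
  \<open>gsin k / gcos k\<close> with \<open>tanh (l t) / l\<close> through their cross difference \<open>W\<close>.\<close>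

lemma gcos_cosh_less:
  fixes k l s t :: real
  assumes k: "k \<ge> 0" and l: "l > 0" and s: "s\<^sup>2 \<ge> k" "2 * l * s > l\<^sup>2 + k" and t: "t > 0"
  shows "gcos k t * cosh (l * t) - s * gsin k t * sinh (l * t) < 1"
proof -
  let ?C = "gcos k" and ?S = "gsin k" and ?ch = "\<lambda>t. cosh (l * t)" and ?sh = "\<lambda>t. sinh (l * t)"
  note der = has_real_derivative_gcos has_real_derivative_gsin
  have "s > 0"
    using s(2) k l by (smt (verit) mult_nonneg_nonpos zero_le_power2)
  \<comment> \<open>\<open>W 0 = 0\<close>, and for positive times \<open>W'\<close> has the sign of
    \<open>l\<^sup>2 - k\<close>.\<close>
  define W where "W t = l * ?S t * ?ch t - ?C t * ?sh t" for t
  have W': "(W has_real_derivative (l\<^sup>2 - k) * (?S t * ?sh t)) (at t)" for t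
    unfolding W_def
    by (auto intro!: derivative_eq_intros der simp: algebra_simps power2_eq_square)
  have W_nonneg: "W t \<ge> 0" if "l\<^sup>2 \<ge> k" "t > 0" for t
  proof -
    have "W 0 \<le> W t"
    proof (rule DERIV_nonneg_imp_nondecreasing[where f = W])
      fix x :: real assume x: "0 \<le> x"
      have "?S x \<ge> 0"
        using gsin_pos[OF k, of x] x by (cases "x = 0") auto
      then show "\<exists>y. (W has_real_derivative y) (at x) \<and> 0 \<le> y"
        using W'[of x] that x l by (intro exI[of _ "(l\<^sup>2 - k) * (?S x * ?sh x)"]) auto
    qed (use that in auto)
    then show ?thesis by (simp add: W_def)
  qed
  have W_nonpos: "W t \<le> 0" if "l\<^sup>2 \<le> k" "t > 0" for t
  proof -
    have "W t \<le> W 0"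
    proof (rule DERIV_nonpos_imp_nonincreasing[where f = W])
      fix x :: real assume x: "0 \<le> x"
      have "?S x \<ge> 0"
        using gsin_pos[OF k, of x] x by (cases "x = 0") auto
      then show "\<exists>y. (W has_real_derivative y) (at x) \<and> y \<le> 0"
        using W'[of x] that x l
        by (intro exI[of _ "(l\<^sup>2 - k) * (?S x * ?sh x)"]) (auto intro!: mult_nonpos_nonneg)
    qed (use that in auto)
    then show ?thesis by (simp add: W_def)
  qed
  \<comment> \<open>Minus the derivative of the left-hand side of the claim.\<close>
  define X where "X t = (s * l - k) * (?S t * ?ch t) + (s - l) * (?C t * ?sh t)" for t
  have X: "X t > 0" if t: "t > 0" for t
  proof -
    have Sch: "?S t * ?ch t > 0" and Csh: "?C t * ?sh t > 0"
      using gsin_pos[OF k t] gcos_pos[OF k, of t] l t by auto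
    have excess: "2 * s * l - k - l\<^sup>2 > 0"
      using s(2) by (simp add: algebra_simps)
    \<comment> \<open>\<open>excess\<close> is \<open>(s * l - k) + l * (s - l)\<close>, so the two
      coefficients in \<open>X\<close> cannot both be negative. If one is, trading its product for
      the other one by means of \<open>W\<close> leaves a positive multiple of \<open>excess\<close>
      and a term whose sign is known from that of \<open>W\<close>.\<close>
    consider (direct) "s \<ge> l" "s * l \<ge> k" | (small) "s < l" | (large) "s \<ge> l" "s * l < k" by linarith
    then show ?thesis
    proof cases
      case direct
      have "s > l \<or> s * l > k"
      proof (rule ccontr)
        assume "\<not> ?thesis"
        then have "s = l" "k = s * l" using direct by auto
        then show False
          using excess by (simp add: power2_eq_square)
      qed
      then show ?thesis
        unfolding X_def using direct Sch Csh
        by (smt (verit, best) mult_nonneg_nonneg mult_pos_pos)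
    next
      case small
      then have "s * l \<ge> s\<^sup>2" "l\<^sup>2 \<ge> s\<^sup>2"
        using \<open>s > 0\<close> by (auto simp: power2_eq_square intro!: mult_mono)
      then have "(s * l - k) * W t \<ge> 0"
        using s(1) W_nonneg[OF _ t] by auto
      moreover have "l * X t = (s * l - k) * W t + (2 * s * l - k - l\<^sup>2) * (?C t * ?sh t)"
        by (simp add: X_def W_def algebra_simps power2_eq_square)
      ultimately have "l * X t > 0"
        using mult_pos_pos[OF excess Csh] by linarith
      then show ?thesis
        using l by (simp add: zero_less_mult_iff)
    next
      case large
      have "l\<^sup>2 \<le> s * l"
        using large(1) l by (simp add: power2_eq_square)
      then have "(s - l) * W t \<le> 0"
        using large W_nonpos[OF _ t] by (intro mult_nonneg_nonpos) auto
      moreover have "X t = (2 * s * l - k - l\<^sup>2) * (?S t * ?ch t) - (s - l) * W t"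
        by (simp add: X_def W_def algebra_simps power2_eq_square)
      ultimately show ?thesis
        using mult_pos_pos[OF excess Sch] by linarith
    qed
  qed
  have der: "((\<lambda>t. ?C t * ?ch t - s * ?S t * ?sh t) has_real_derivative - X t) (at t)" for t
    unfolding X_def by (auto intro!: derivative_eq_intros der simp: algebra_simps)
  have "?C t * ?ch t - s * ?S t * ?sh t < ?C 0 * ?ch 0 - s * ?S 0 * ?sh 0"
  proof (rule DERIV_neg_imp_decreasing_open[OF t])
    show "\<exists>y. ((\<lambda>t. ?C t * ?ch t - s * ?S t * ?sh t) has_real_derivative y) (at x) \<and> y < 0" if "0 < x" for x
      using der[of x] X[OF that] by (intro exI[of _ "- X x"]) auto
    show "continuous_on {0..t} (\<lambda>t. ?C t * ?ch t - s * ?S t * ?sh t)"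
      using der by (meson DERIV_isCont continuous_at_imp_continuous_on)
  qed
  then show ?thesis by simp
qed

section \<open>Symplectic planes with a hyperbolic generator\<close>

context skew_pair
begin

text \<open>For \<open>c = l\<close> and \<open>c = - l\<close>, \<open>(B - c) (B + c) = 0\<close>
  on \<open>V\<close>, so nonzero values of \<open>B + c\<close> are eigenvectors for
  \<open>c\<close>. They exist: a skew operator acting as a nonzero scalar would force \<omega> to
  vanish on \<open>V\<close>, against \<open>pos\<close>.\<close>

lemma hyperbolic_plane_basis:
  assumes l: "l > 0" and BB: "\<And>x. x \<in> V \<Longrightarrow> endo_apply B (endo_apply B x) = l\<^sup>2 *\<^sub>R x" and dim: "dim V = 2"
  obtains e f where "e \<in> V" "f \<in> V" "endo_apply B e = l *\<^sub>R e" "endo_apply B f = - l *\<^sub>R f"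
    "\<And>x. x \<in> V \<Longrightarrow> \<exists>p q. x = p *\<^sub>R e + q *\<^sub>R f" "\<omega> e f \<noteq> 0"
proof -
  have "V \<noteq> {0}"
    using dim by auto
  then obtain v where v: "v \<in> V" "v \<noteq> 0"
    using V subspace_0 by blast
  have eigen: "\<exists>e\<in>V. e \<noteq> 0 \<and> endo_apply B e = c *\<^sub>R e" if c: "c\<^sup>2 = l\<^sup>2" for c
  proof -
    have "c \<noteq> 0"
      using c l by auto
    have "\<exists>x\<in>V. endo_apply B x + c *\<^sub>R x \<noteq> 0"
    proof (rule ccontr)
      assume "\<not> ?thesis"
      then have *: "endo_apply B x = - c *\<^sub>R x" if "x \<in> V" for x
        using that by (metis add_eq_0_iff2 scaleR_minus_left)
      have "\<omega> x y = 0" if "x \<in> V" "y \<in> V" for x y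
        using B_skew[OF that] *[OF that(1)] *[OF that(2)] \<open>c \<noteq> 0\<close>
        by (simp add: \<omega>.scaleR_left \<omega>.scaleR_right \<omega>.minus_left \<omega>.minus_right)
      then have "\<omega> v (endo_apply (A + B) v) = 0"
        using v by (simp add: endo.add_left subspace_add[OF V] A_in B_in)
      then show False
        using pos[OF v] by simp
    qed
    then obtain x where x: "x \<in> V" "endo_apply B x + c *\<^sub>R x \<noteq> 0" by blast
    show ?thesis
      using x V c
      by (intro bexI[of _ "endo_apply B x + c *\<^sub>R x"])
         (auto simp: endo.add_right endo.scaleR_right BB B_in subspace_add subspace_scale
            scaleR_add_right power2_eq_square)
  qed
  obtain e where e: "e \<in> V" "e \<noteq> 0" "endo_apply B e = l *\<^sub>R e"
    using eigen[of l] by auto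
  obtain f where f: "f \<in> V" "f \<noteq> 0" "endo_apply B f = - l *\<^sub>R f"
    using eigen[of "- l"] by auto
  have "e \<notin> span {f}"
  proof
    assume "e \<in> span {f}"
    then obtain r where "e = r *\<^sub>R f"
      by (auto simp: span_singleton)
    then have "l *\<^sub>R e = - l *\<^sub>R e"
      using e(3) f(3) by (simp add: endo.scaleR_right mult.commute)
    then show False
      using e(2) l by (metis scaleR_right_imp_eq less_irrefl neg_less_0_iff_less order_less_trans)
  qed
  then have ind: "independent {e, f}" "e \<noteq> f"
    using f(2) by (auto simp: independent_insert span_base)
  have "V \<subseteq> span {e, f}"
    using card_eq_dim[of "{e, f}" V] ind e(1) f(1) dim by simp
  have coords: "\<exists>p q. x = p *\<^sub>R e + q *\<^sub>R f" if "x \<in> V" for x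
  proof -
    have "x \<in> span {e, f}"
      using \<open>V \<subseteq> span {e, f}\<close> that by blast
    then obtain p q where "x - p *\<^sub>R e = q *\<^sub>R f"
      by (auto simp: span_insert[of e] span_singleton)
    then have "x = p *\<^sub>R e + q *\<^sub>R f"
      by (simp add: diff_eq_eq add.commute)
    then show ?thesis by blast
  qed
  have "\<omega> e f \<noteq> 0"
  proof
    assume "\<omega> e f = 0"
    moreover obtain p q p' q' where "v = p *\<^sub>R e + q *\<^sub>R f"
        "endo_apply (A + B) v = p' *\<^sub>R e + q' *\<^sub>R f"
      using coords[OF v(1)] coords[of "endo_apply (A + B) v"] v(1)
      by (auto simp: endo.add_left subspace_add[OF V] A_in B_in)
    ultimately have "\<omega> v (endo_apply (A + B) v) = 0"
      using antisym[OF e(1) f(1)] \<omega>_self[OF e(1)] \<omega>_self[OF f(1)]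
      by (simp add: \<omega>.add_left \<omega>.add_right \<omega>.scaleR_left \<omega>.scaleR_right)
    then show False
      using pos[OF v] by simp
  qed
  then show ?thesis
    using that e f coords by blast
qed

text \<open>In the basis \<open>e, f\<close> the form is a multiple of the determinant and \<open>A\<close> is a trace-free matrix, so
  \<open>A\<^sup>2 = k\<close>; for \<open>k \<ge> 0\<close> a fixed vector would force \<open>gcos k \<tau> cosh (l \<tau>) + \<alpha> gsin k \<tau> sinh (l \<tau>) = 1\<close>, which
  positivity of \<open>A + B\<close> rules out.\<close>

proposition fixed_vector_imp_negative_square:
  assumes l: "l > 0" and BB: "\<And>x. x \<in> V \<Longrightarrow> endo_apply B (endo_apply B x) = l\<^sup>2 *\<^sub>R x" and dim: "dim V = 2"
    and \<tau>: "\<tau> > 0" and x: "x \<in> V" "x \<noteq> 0"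
    and fix_x: "endo_apply (exp (\<tau> *\<^sub>R A)) (endo_apply (exp (\<tau> *\<^sub>R B)) x) = x"
  obtains k where "k < 0" "\<And>y. y \<in> V \<Longrightarrow> endo_apply A (endo_apply A y) = k *\<^sub>R y"
proof -
  obtain e f where e: "e \<in> V" "endo_apply B e = l *\<^sub>R e" and f: "f \<in> V" "endo_apply B f = - l *\<^sub>R f"
    and coords: "\<And>x. x \<in> V \<Longrightarrow> \<exists>p q. x = p *\<^sub>R e + q *\<^sub>R f" and ef: "\<omega> e f \<noteq> 0"
    using hyperbolic_plane_basis[OF l BB dim] by metis
  note \<omega>_simps = \<omega>.add_left \<omega>.add_right \<omega>.scaleR_left \<omega>.scaleR_right \<omega>_self[OF e(1)] \<omega>_self[OF f(1)]
    antisym[OF f(1) e(1)]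
  have eq_iff: "p *\<^sub>R e + q *\<^sub>R f = p' *\<^sub>R e + q' *\<^sub>R f \<longleftrightarrow> p = p' \<and> q = q'" for p q p' q'
  proof
    assume *: "p *\<^sub>R e + q *\<^sub>R f = p' *\<^sub>R e + q' *\<^sub>R f"
    have "\<omega> (p *\<^sub>R e + q *\<^sub>R f) f = \<omega> (p' *\<^sub>R e + q' *\<^sub>R f) f"
      "\<omega> e (p *\<^sub>R e + q *\<^sub>R f) = \<omega> e (p' *\<^sub>R e + q' *\<^sub>R f)"
      by (simp_all only: *)
    then show "p = p' \<and> q = q'"
      using ef by (simp add: \<omega>_simps)
  qed auto
  obtain \<alpha> \<beta> where Ae: "endo_apply A e = \<alpha> *\<^sub>R e + \<beta> *\<^sub>R f"
    using coords[OF A_in[OF e(1)]] by blast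
  obtain \<gamma> \<delta> where "endo_apply A f = \<gamma> *\<^sub>R e + \<delta> *\<^sub>R f"
    using coords[OF A_in[OF f(1)]] by blast
  \<comment> \<open>Skewness for an area form means zero trace.\<close>
  moreover have "\<delta> = - \<alpha>"
    using A_skew[OF e(1) f(1)] ef by (simp add: Ae \<open>endo_apply A f = _\<close> \<omega>_simps) (metis
      add.inverse_inverse mult_cancel_right mult_minus_left)
  ultimately have Af: "endo_apply A f = \<gamma> *\<^sub>R e - \<alpha> *\<^sub>R f"
    by simp
  have quad: "\<omega> e f * (\<beta> * p\<^sup>2 - 2 * (\<alpha> + l) * (p * q) - \<gamma> * q\<^sup>2) > 0" if "p \<noteq> 0 \<or> q \<noteq> 0" for p q
  proof -
    have "p *\<^sub>R e + q *\<^sub>R f \<noteq> 0"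
      using eq_iff[of p q 0 0] that by auto
    then have "\<omega> (p *\<^sub>R e + q *\<^sub>R f) (endo_apply (A + B) (p *\<^sub>R e + q *\<^sub>R f)) > 0"
      using e f V by (intro pos) (auto intro!: subspace_add subspace_scale)
    also have "\<omega> (p *\<^sub>R e + q *\<^sub>R f) (endo_apply (A + B) (p *\<^sub>R e + q *\<^sub>R f)) =
        \<omega> e f * (\<beta> * p\<^sup>2 - 2 * (\<alpha> + l) * (p * q) - \<gamma> * q\<^sup>2)"
      by (simp add: endo.add_left endo.add_right endo.scaleR_right Ae Af e(2) f(2) \<omega>_simps
          \<omega>.diff_right \<omega>.minus_right power2_eq_square algebra_simps)
    finally show ?thesis .
  qed
  have \<beta>: "\<omega> e f * \<beta> > 0"
    using quad[of 1 0] by simp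
  then have "\<beta> \<noteq> 0" by auto
  \<comment> \<open>For \<open>q = \<beta>\<close> the quadratic form is minimal at
    \<open>p = \<alpha> + l\<close>, where its value exposes the discriminant.\<close>
  then have "(\<omega> e f * \<beta>) * (- (\<alpha> + l)\<^sup>2 - \<beta> * \<gamma>) > 0"
    using quad[of "\<alpha> + l" \<beta>] by (simp add: power2_eq_square algebra_simps)
  then have disc: "- (\<beta> * \<gamma>) > (\<alpha> + l)\<^sup>2"
    using \<beta> by (simp add: zero_less_mult_iff)
  \<comment> \<open>Minus the determinant of the trace-free matrix of \<open>A\<close>;
    \<open>AA\<close> is its Cayley-Hamilton identity.\<close>
  define k where "k = \<alpha>\<^sup>2 + \<beta> * \<gamma>"
  have AA: "endo_apply A (endo_apply A y) = k *\<^sub>R y" if "y \<in> V" for y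
    using coords[OF that]
    by (auto simp: endo.add_right endo.diff_right endo.scaleR_right Ae Af k_def power2_eq_square algebra_simps)
  have "k < 0"
  proof (rule ccontr)
    assume "\<not> k < 0"
    then have k: "k \<ge> 0" by simp
    define E where "E = exp (l * \<tau>)"
    define C where "C = gcos k \<tau>"
    define S where "S = gsin k \<tau>"
    obtain p q where pq: "x = p *\<^sub>R e + q *\<^sub>R f"
      using coords[OF x(1)] by blast
    \<comment> \<open>\<open>P\<close> and \<open>Q\<close> are the coordinates of
      \<open>exp (\<tau> B) x\<close>; the fixed vector equation then says that
      \<open>exp (\<tau> A)\<close> maps \<open>(P, Q)\<close> to
      \<open>(P / E, Q * E)\<close>.\<close>
    define P where "P = p * E"
    define Q where "Q = q / E"
    have E: "E > 0"
      by (simp add: E_def)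
    have PQ: "P \<noteq> 0 \<or> Q \<noteq> 0" "p = P / E" "q = Q * E"
      using x(2) pq E by (auto simp: P_def Q_def)
    have "endo_apply (exp (\<tau> *\<^sub>R B)) x = P *\<^sub>R e + Q *\<^sub>R f"
      by (simp add: pq endo.add_right endo.scaleR_right exp_endo_eigenvector[OF e(2)]
          exp_endo_eigenvector[OF f(2)] P_def Q_def E_def exp_minus divide_inverse)
    then have "(P / E) *\<^sub>R e + (Q * E) *\<^sub>R f = endo_apply (exp (\<tau> *\<^sub>R A)) (P *\<^sub>R e + Q *\<^sub>R f)"
      using fix_x pq PQ by simp
    also have "\<dots> = C *\<^sub>R (P *\<^sub>R e + Q *\<^sub>R f) + S *\<^sub>R endo_apply A (P *\<^sub>R e + Q *\<^sub>R f)"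
      using e(1) f(1) V unfolding C_def S_def
      by (intro exp_endo_eq_gcos_gsin AA) (auto intro!: subspace_add subspace_scale)
    also have "\<dots> = (C * P + S * (\<alpha> * P + \<gamma> * Q)) *\<^sub>R e + (C * Q + S * (\<beta> * P - \<alpha> * Q)) *\<^sub>R f"
      by (simp add: endo.add_right endo.scaleR_right Ae Af algebra_simps)
    finally have eqs: "P / E = C * P + S * (\<alpha> * P + \<gamma> * Q)" "Q * E = C * Q + S * (\<beta> * P - \<alpha> * Q)"
      by (simp_all add: eq_iff)
    have lin1: "(C + S * \<alpha> - 1 / E) * P + (S * \<gamma>) * Q = 0"
      and lin2: "(S * \<beta>) * P + (C - S * \<alpha> - E) * Q = 0"
      using eqs by (simp_all add: algebra_simps)
    \<comment> \<open>The determinant of the system \<open>lin1\<close>, \<open>lin2\<close>; it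
      vanishes by Cramer's rule, as \<open>(P, Q)\<close> is not zero.\<close>
    define \<Delta> where "\<Delta> = (C + S * \<alpha> - 1 / E) * (C - S * \<alpha> - E) - (S * \<gamma>) * (S * \<beta>)"
    have "\<Delta> * P = (C - S * \<alpha> - E) * ((C + S * \<alpha> - 1 / E) * P + (S * \<gamma>) * Q)
        - (S * \<gamma>) * ((S * \<beta>) * P + (C - S * \<alpha> - E) * Q)"
      "\<Delta> * Q = (C + S * \<alpha> - 1 / E) * ((S * \<beta>) * P + (C - S * \<alpha> - E) * Q)
        - (S * \<beta>) * ((C + S * \<alpha> - 1 / E) * P + (S * \<gamma>) * Q)"
      unfolding \<Delta>_def by algebra+
    then have "\<Delta> = 0"
      using lin1 lin2 PQ(1) by auto
    moreover have "\<Delta> = C\<^sup>2 - k * S\<^sup>2 + E * (1 / E) - C * (E + 1 / E) - S * \<alpha> * (E - 1 / E)"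
      by (simp add: \<Delta>_def k_def power2_eq_square algebra_simps)
    moreover have "C\<^sup>2 - k * S\<^sup>2 = 1" "E * (1 / E) = 1"
      using gcos_square[of k \<tau>] E by (simp_all add: C_def S_def)
    ultimately have "2 - C * (E + 1 / E) - S * \<alpha> * (E - 1 / E) = 0"
      by simp
    then have "C * cosh (l * \<tau>) - (- \<alpha>) * S * sinh (l * \<tau>) = 1"
      by (simp add: cosh_def sinh_def E_def exp_minus inverse_eq_divide algebra_simps)
    moreover have "C * cosh (l * \<tau>) - (- \<alpha>) * S * sinh (l * \<tau>) < 1"
      unfolding C_def S_def
    \<comment> \<open>Here \<open>s = - \<alpha>\<close>; both conditions on \<open>s\<close> are
      consequences of \<open>disc\<close>.\<close>
    proof (rule gcos_cosh_less[OF k l _ _ \<tau>])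
      have "- (\<beta> * \<gamma>) > 0"
        using disc by (smt (verit) zero_le_power2)
      then show "(- \<alpha>)\<^sup>2 \<ge> k"
        by (simp add: k_def)
      show "2 * l * (- \<alpha>) > l\<^sup>2 + k"
        using disc by (simp add: k_def power2_eq_square algebra_simps)
    qed
    ultimately show False by simp
  qed
  then show ?thesis
    using that AA by blast
qed

end

section \<open>Lie algebras\<close>

lemma lin_trace_comp_commute:
  fixes f g :: "'a::euclidean_space \<Rightarrow> 'a"
  assumes "linear f" "linear g"
  shows "lin_trace (\<lambda>w. f (g w)) = lin_trace (\<lambda>w. g (f w))"
proof -
  have expand: "h (k b) \<bullet> b = (\<Sum>b'\<in>Basis. (k b \<bullet> b') * (h b' \<bullet> b))" if "linear h" for h k :: "'a \<Rightarrow> 'a" and b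
  proof -
    have "h (k b) = h (\<Sum>b'\<in>Basis. (k b \<bullet> b') *\<^sub>R b')"
      by (simp add: euclidean_representation)
    also have "\<dots> = (\<Sum>b'\<in>Basis. (k b \<bullet> b') *\<^sub>R h b')"
      using that by (simp add: linear_sum linear_scale)
    finally show ?thesis
      by (simp add: inner_sum_left)
  qed
  show ?thesis
    unfolding lin_trace_def expand[OF assms(1), of g] expand[OF assms(2), of f]
    by (subst sum.swap) (simp add: mult.commute)
qed

lemma lin_trace_diff: "lin_trace (\<lambda>w. f w - g w) = lin_trace f - lin_trace g"
  by (simp add: lin_trace_def inner_diff_left sum_subtractf)

context
  fixes br :: "'a::euclidean_space \<Rightarrow> 'a \<Rightarrow> 'a"
  assumes lie: "lie_algebra br"
begin

lemma bilinear_lie: "bilinear br"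
  using lie by (simp add: lie_algebra_def)

lemma linear_ad: "linear (br u)"
  using bilinear_lie by (simp add: bilinear_def)

lemma lie_antisym: "br u v = - br v u"
proof -
  have "br (u + v) (u + v) = 0" "br u u = 0" "br v v = 0"
    using lie by (simp_all add: lie_algebra_def)
  then show ?thesis
    using bilinear_lie by (simp add: bilinear_ladd bilinear_radd eq_neg_iff_add_eq_0)
qed

lemma ad_bracket: "br (br u v) w = br u (br v w) - br v (br u w)"
proof -
  have "br u (br v w) + br v (br w u) + br w (br u v) = 0"
    using lie by (simp add: lie_algebra_def)
  moreover have "br v (br w u) = - br v (br u w)"
    using lie_antisym[of w u] bilinear_lie by (simp add: bilinear_rneg)
  moreover have "br w (br u v) = - br (br u v) w"
    by (rule lie_antisym)
  ultimately show ?thesis by (simp add: algebra_simps)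
qed

lemma bilinear_killing_form: "bilinear (killing_form br)"
  unfolding bilinear_def killing_form_def lin_trace_def
  using bilinear_lie
  by (auto intro!: linearI simp: bilinear_ladd bilinear_radd bilinear_lmul bilinear_rmul
      inner_add_left sum.distrib sum_distrib_left)

lemma killing_form_commute: "killing_form br u v = killing_form br v u"
  unfolding killing_form_def by (rule lin_trace_comp_commute[OF linear_ad linear_ad])

text \<open>Invariance: after expanding both brackets by \<open>ad_bracket\<close> two traces
  cancel, and the other two agree by cyclicity.\<close>

lemma killing_form_skew: "killing_form br (br x y) z = - killing_form br y (br x z)"
proof -
  have "killing_form br (br x y) z + killing_form br y (br x z) =
      lin_trace (\<lambda>w. br x (br y (br z w))) - lin_trace (\<lambda>w. br y (br z (br x w)))"
    using bilinear_lie unfolding killing_form_def ad_bracket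
    by (simp add: bilinear_rsub lin_trace_diff)
  also have "lin_trace (\<lambda>w. br y (br z (br x w))) = lin_trace (\<lambda>w. br x (br y (br z w)))"
    using lin_trace_comp_commute[of "\<lambda>w. br y (br z w)" "br x"] linear_ad linear_compose[OF linear_ad linear_ad]
    by (simp add: o_def)
  finally show ?thesis by simp
qed

end

section \<open>Centralizers of commuting regular elements\<close>

lemma diagonalizable_over_C_square_eq_0:
  assumes f: "linear f" and diag: "diagonalizable_over_C f" and v: "f (f v) = 0"
  shows "f v = 0"
proof -
  let ?T = "map_prod f f"
  obtain B where B: "cplx.independent B" "cplx.span B = UNIV" "\<forall>b\<in>B. \<exists>c. ?T b = cscale c b"
    using diag by (auto simp: diagonalizable_over_C_def)
  then obtain c where c: "\<And>b. b \<in> B \<Longrightarrow> ?T b = cscale (c b) b"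
    by metis
  have "linear ?T"
    using f by (auto intro!: linearI simp: linear_add linear_scale)
  have T_scale: "?T (cscale k w) = cscale k (?T w)" for k w
    using f by (cases w) (simp add: cscale_def linear_add linear_diff linear_scale)
  have "(v, 0) \<in> cplx.span B"
    using B by simp
  then obtain S r where S: "finite S" "S \<subseteq> B" and r: "(v, 0) = (\<Sum>b\<in>S. cscale (r b) b)"
    by (auto simp: cplx.span_explicit)
  have step: "?T (\<Sum>b\<in>S. cscale (k b) b) = (\<Sum>b\<in>S. cscale (k b * c b) b)" for k
    unfolding linear_sum[OF \<open>linear ?T\<close>]
  proof (intro sum.cong refl)
    fix b assume "b \<in> S"
    then have "?T b = cscale (c b) b"
      using S(2) by (intro c) blast
    then show "?T (cscale (k b) b) = cscale (k b * c b) b"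
      by (simp only: T_scale cplx.scale_scale)
  qed
  \<comment> \<open>In an eigenbasis each coefficient of \<open>f (f v)\<close> is
    \<open>r b * c b * c b\<close>; when it is 0, so is the coefficient \<open>r b * c b\<close> of
    \<open>f v\<close>.\<close>
  have "(\<Sum>b\<in>S. cscale (r b * c b * c b) b) = ?T (?T (v, 0))"
    unfolding r step by simp
  also have "\<dots> = 0"
    using v linear_0[OF f] by (simp add: zero_prod_def)
  finally have "r b * c b * c b = 0" if "b \<in> S" for b
    using cplx.independentD[OF B(1) S _ that, of "\<lambda>b. r b * c b * c b"] by simp
  then have "(\<Sum>b\<in>S. cscale (r b * c b) b) = 0"
    by (intro sum.neutral) (auto simp: cplx.scale_zero_left)
  then have "?T (v, 0) = 0"
    unfolding r step .
  then show ?thesis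
    by (simp add: zero_prod_def)
qed

text \<open>The centralizer of \<open>u + \<epsilon> p\<close> is contained in that of \<open>u\<close> for small \<open>\<epsilon> > 0\<close>, hence equal to it by
  regularity of \<open>u\<close>; so \<open>p\<close> commutes with the whole centralizer of \<open>u\<close>.\<close>

lemma commuting_regular_centralizer:
  fixes br :: "'a::euclidean_space \<Rightarrow> 'a \<Rightarrow> 'a"
  assumes lie: "lie_algebra br" and u: "regular_element br u" "semisimple_element br u"
    and p: "regular_element br p" and comm: "br u p = 0"
  shows "lie_centralizer br p = lie_centralizer br u"
proof -
  note lin = linear_ad[OF lie] and bil = bilinear_lie[OF lie]
  have sub: "subspace (lie_centralizer br x)" for x
    using bil by (simp add: subspace_def lie_centralizer_def bilinear_rzero bilinear_radd bilinear_rmul)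
  have commute: "br u (br p v) = br p (br u v)" for v
    using ad_bracket[OF lie, of u p v] comm bil by (simp add: bilinear_lzero)
  have square: "br u v = 0" if "br u (br u v) = 0" for v
    using diagonalizable_over_C_square_eq_0[OF lin] u(2) that by (auto simp: semisimple_element_def)
  have sub_range: "subspace (range (br u))"
    using linear_subspace_image[OF lin subspace_UNIV] .
  \<comment> \<open>Semisimplicity makes \<open>ad u\<close> injective on its own range, hence
    bounded below there by some \<open>m\<close>.\<close>
  have "\<forall>x\<in>range (br u). br u x = 0 \<longrightarrow> x = 0"
    using square by (intro ballI impI, elim imageE) simp
  from injective_imp_isometric[OF closed_subspace[OF sub_range] sub_range _ this]
  obtain m where m: "m > 0" "\<And>x. x \<in> range (br u) \<Longrightarrow> m * norm x \<le> norm (br u x)"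
    using lin linear_conv_bounded_linear by blast
  obtain K where K: "K > 0" "\<And>x. norm (br p x) \<le> K * norm x"
    using linear_bounded_pos[OF lin] by blast
  \<comment> \<open>Small enough for \<open>\<epsilon> ad p\<close> to have norm at most
    \<open>m / 2\<close>, so that \<open>ad u + \<epsilon> ad p\<close> stays injective on the range
    of \<open>ad u\<close>.\<close>
  define \<epsilon> where "\<epsilon> = m / (2 * K)"
  have \<epsilon>: "\<epsilon> > 0" "\<epsilon> * K = m / 2"
    using m K by (auto simp: \<epsilon>_def)
  have inj: "b = 0" if "b \<in> range (br u)" "br u b + \<epsilon> *\<^sub>R br p b = 0" for b
  proof -
    have "norm (br u b) = \<epsilon> * norm (br p b)"
      using that(2) \<epsilon>(1) by (metis abs_of_pos add_eq_0_iff norm_minus_cancel norm_scaleR)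
    also have "\<dots> \<le> \<epsilon> * (K * norm b)"
      using K(2) \<epsilon>(1) by (intro mult_left_mono) auto
    also have "\<dots> = m / 2 * norm b"
      using \<epsilon>(2) by (simp add: mult.assoc[symmetric])
    finally have "m * norm b \<le> m / 2 * norm b"
      using m(2)[OF that(1)] by linarith
    then show ?thesis
      using m(1) by simp
  qed
  have ad_eq: "br (u + \<epsilon> *\<^sub>R p) v = br u v + \<epsilon> *\<^sub>R br p v" for v
    using bil by (simp add: bilinear_ladd bilinear_lmul)
  have "lie_centralizer br (u + \<epsilon> *\<^sub>R p) \<subseteq> lie_centralizer br u"
  proof
    fix v assume "v \<in> lie_centralizer br (u + \<epsilon> *\<^sub>R p)"
    then have v: "br u v + \<epsilon> *\<^sub>R br p v = 0"
      by (simp add: lie_centralizer_def ad_eq)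
    \<comment> \<open>\<open>ad u\<close> commutes with \<open>ad (u + \<epsilon> p)\<close>, so the
      latter annihilates \<open>br u v\<close>, which lies in the range of
      \<open>ad u\<close>.\<close>
    have "br u (br u v) + \<epsilon> *\<^sub>R br p (br u v) = br u (br u v + \<epsilon> *\<^sub>R br p v)"
      using bil by (simp add: bilinear_radd bilinear_rmul commute)
    also have "\<dots> = 0"
      using v bil by (simp add: bilinear_rzero)
    finally show "v \<in> lie_centralizer br u"
      using inj[of "br u v"] by (simp add: lie_centralizer_def)
  qed
  then have eq: "lie_centralizer br (u + \<epsilon> *\<^sub>R p) = lie_centralizer br u"
    using u(1) by (intro subspace_dim_equal sub) (auto simp: regular_element_def)
  have "lie_centralizer br u \<subseteq> lie_centralizer br p"
  proof
    fix a assume a: "a \<in> lie_centralizer br u"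
    then have "a \<in> lie_centralizer br (u + \<epsilon> *\<^sub>R p)"
      by (simp only: eq)
    then have "br u a + \<epsilon> *\<^sub>R br p a = 0"
      by (simp add: lie_centralizer_def ad_eq)
    then show "a \<in> lie_centralizer br p"
      using a \<epsilon>(1) by (simp add: lie_centralizer_def)
  qed
  \<comment> \<open>Regularity of \<open>p\<close> bounds the dimension of its centralizer, turning
    the inclusion into equality.\<close>
  then show ?thesis
    using p by (intro subspace_dim_equal[symmetric] sub) (auto simp: regular_element_def)
qed

text \<open>Since \<open>(f - k) (f + k) = 0\<close> on \<open>V\<close>, the vector
  \<open>w = (f + k) v\<close> is an eigenvector for \<open>k\<close>, unless it is 0 and
  \<open>v\<close> is one for \<open>- k\<close>.\<close>

lemma complex_eigenvalue_on_square_eigenspace: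
  assumes f: "linear f" and V: "V = {v. f (f v) = c *\<^sub>R v}" "V \<noteq> {0}" and k: "k\<^sup>2 = complex_of_real c"
  obtains k' where "k' = k \<or> k' = - k" "complex_eigenvalue_on f V k'"
proof -
  have k_parts: "Re k * Re k - Im k * Im k = c" "Re k * Im k = 0"
    using k by (auto simp: complex_eq_iff power2_eq_square)
  have f_in: "f x \<in> V" if "x \<in> V" for x
    using that f by (simp add: V linear_scale)
  have sub: "subspace V"
    using f unfolding V by (auto simp: subspace_def linear_0 linear_add linear_scale algebra_simps)
  obtain v where v: "v \<in> V" "v \<noteq> 0"
    using V(2) subspace_0[OF sub] by blast
  define w where "w = (f v + Re k *\<^sub>R v, Im k *\<^sub>R v)"
  show ?thesis
  proof (cases "w = 0")
    case True
    then have "Im k = 0" "f v = - Re k *\<^sub>R v"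
      using v by (auto simp: w_def zero_prod_def add_eq_0_iff2)
    then have "map_prod f f (v, 0) = cscale (- k) (v, 0)"
      using linear_0[OF f] by (simp add: cscale_def)
    then have "complex_eigenvalue_on f V (- k)"
      using v subspace_0[OF sub] unfolding complex_eigenvalue_on_def
      by (intro bexI[of _ "(v, 0)"]) (auto simp: zero_prod_def)
    then show ?thesis
      using that by blast
  next
    case False
    have fv: "f (f v) = (Re k * Re k) *\<^sub>R v - (Im k * Im k) *\<^sub>R v"
      using v(1) k_parts(1) by (simp add: V flip: scaleR_diff_left)
    have "map_prod f f w = cscale k w"
      using k_parts(2) f
      by (auto simp: w_def cscale_def linear_add linear_scale fv scaleR_add_right mult.commute)
    moreover have "w \<in> V \<times> V"
      using v f_in sub by (auto simp: w_def subspace_add subspace_scale)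
    ultimately have "complex_eigenvalue_on f V k"
      using False unfolding complex_eigenvalue_on_def by blast
    then show ?thesis
      using that by blast
  qed
qed

section \<open>The linearized Euler equation on an eigenspace\<close>

text \<open>The data at the identity only; the group and its translations enter after this
  locale.\<close>

locale euler_eigenspace =
  fixes br :: "'a::euclidean_space \<Rightarrow> 'a \<Rightarrow> 'a" and ip :: "'a \<Rightarrow> 'a \<Rightarrow> real"
    and \<Lambda> :: "'a \<Rightarrow> 'a" and u0 :: 'a and c :: real and V :: "'a set"
  assumes lie: "lie_algebra br"
    and ip_pos: "u \<noteq> 0 \<Longrightarrow> ip u u > 0"
    and linear_\<Lambda>: "linear \<Lambda>" and bij_\<Lambda>: "bij \<Lambda>"
    and \<Lambda>_sym: "killing_form br (\<Lambda> u) v = killing_form br u (\<Lambda> v)"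
    and ip_eq: "ip u v = killing_form br u (\<Lambda> v)"
    and u0: "regular_element br u0" "semisimple_element br u0"
    and p: "regular_element br (\<Lambda> u0)" "br u0 (\<Lambda> u0) = 0"
    and c: "c \<noteq> 0" and V_eq: "V = {v. br u0 (br u0 v) = c *\<^sub>R v}" and V_nontrivial: "V \<noteq> {0}"
    and \<Lambda>_in: "\<Lambda> ` V \<subseteq> V"
begin

definition L :: "'a endo" where "L = endo_of (br u0)"
definition P :: "'a endo" where "P = endo_of (br (\<Lambda> u0))"
definition \<Lambda>_inv :: "'a endo" where "\<Lambda>_inv = endo_of (inv_into UNIV \<Lambda>)"
  \<comment> \<open>not \<open>inv \<Lambda>\<close>, which HOL-Algebra reads as an inverse in a monoid\<close>
definition T :: "'a endo" where "T = \<Lambda>_inv * P"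
definition A :: "'a endo" where "A = T - L"
text \<open>By invariance this is \<open>killing_form br (\<Lambda> u0) (br x y)\<close>, the
  Kirillov-Kostant form at the momentum \<open>\<Lambda> u0\<close>.\<close>

definition \<omega> :: "'a \<Rightarrow> 'a \<Rightarrow> real" where "\<omega> x y = killing_form br (endo_apply P x) y"

abbreviation \<kappa> :: "'a \<Rightarrow> 'a \<Rightarrow> real" where "\<kappa> \<equiv> killing_form br"

sublocale \<kappa>: bounded_bilinear \<kappa>
  using bilinear_killing_form[OF lie] by (simp add: bilinear_conv_bounded_bilinear)

lemma L_apply: "endo_apply L x = br u0 x"
  and P_apply: "endo_apply P x = br (\<Lambda> u0) x"
  by (simp_all add: L_def P_def endo_apply_endo_of[OF linear_ad[OF lie]])

lemma linear_inv_\<Lambda>: "linear (inv_into UNIV \<Lambda>)"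
  using linear_\<Lambda> bij_\<Lambda> by (metis bij_is_inj linear_injective_isomorphism inv_unique_comp comp_def id_apply ext)

lemma \<Lambda>_inv_apply: "endo_apply \<Lambda>_inv x = inv_into UNIV \<Lambda> x"
  by (simp add: \<Lambda>_inv_def endo_apply_endo_of[OF linear_inv_\<Lambda>])

lemma \<Lambda>_\<Lambda>_inv [simp]: "\<Lambda> (endo_apply \<Lambda>_inv x) = x"
  using bij_\<Lambda> by (simp add: \<Lambda>_inv_apply bij_is_surj surj_f_inv_f)

lemma \<Lambda>_inv_\<Lambda> [simp]: "endo_apply \<Lambda>_inv (\<Lambda> x) = x"
  using bij_\<Lambda> by (simp add: \<Lambda>_inv_apply bij_is_inj inv_f_f)

lemma L_P_commute: "endo_apply L (endo_apply P x) = endo_apply P (endo_apply L x)"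
  using ad_bracket[OF lie, of u0 "\<Lambda> u0" x] p(2) bilinear_lie[OF lie]
  by (simp add: L_apply P_apply bilinear_lzero)

lemma V: "subspace V"
  unfolding V_eq using linear_ad[OF lie, of u0]
  by (auto simp: subspace_def linear_0 linear_add linear_scale algebra_simps)

lemma L_square: "x \<in> V \<Longrightarrow> endo_apply L (endo_apply L x) = c *\<^sub>R x"
  by (simp add: V_eq L_apply)

lemma in_V_iff: "x \<in> V \<longleftrightarrow> endo_apply L (endo_apply L x) = c *\<^sub>R x"
  by (simp add: V_eq L_apply)

lemma L_in: "x \<in> V \<Longrightarrow> endo_apply L x \<in> V"
  by (simp add: in_V_iff endo.scaleR_right)

lemma P_in: "x \<in> V \<Longrightarrow> endo_apply P x \<in> V"
  by (simp add: in_V_iff L_P_commute endo.scaleR_right)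

lemma \<Lambda>_inv_in: "x \<in> V \<Longrightarrow> endo_apply \<Lambda>_inv x \<in> V"
proof -
  have "\<Lambda> ` V = V"
  proof (rule subspace_dim_equal[OF linear_subspace_image[OF linear_\<Lambda> V] V \<Lambda>_in])
    have "inj_on \<Lambda> (span V)"
      using bij_\<Lambda> inj_on_subset by (auto simp: bij_def)
    then show "dim V \<le> dim (\<Lambda> ` V)"
      by (simp add: dim_image_eq[OF linear_\<Lambda>])
  qed
  then show "endo_apply \<Lambda>_inv x \<in> V" if "x \<in> V"
    using that by (metis \<Lambda>_inv_\<Lambda> imageE)
qed

lemma T_in: "x \<in> V \<Longrightarrow> endo_apply T x \<in> V"
  by (simp add: T_def P_in \<Lambda>_inv_in)

lemma A_in: "x \<in> V \<Longrightarrow> endo_apply A x \<in> V"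
  by (simp add: A_def endo.diff_left T_in L_in subspace_diff[OF V])

text \<open>The kernels of \<open>P\<close> and \<open>L\<close> are the centralizers of
  \<open>\<Lambda> u0\<close> and \<open>u0\<close>, which coincide, and \<open>L\<close> squares to
  a nonzero scalar on \<open>V\<close>.\<close>

lemma T_eq_0: "x = 0" if "x \<in> V" "endo_apply T x = 0"
proof -
  have "endo_apply P x = 0"
    using that(2) linear_0[OF linear_\<Lambda>] by (metis T_def endo_apply_times \<Lambda>_\<Lambda>_inv)
  then have "endo_apply L x = 0"
    using commuting_regular_centralizer[OF lie u0 p]
    by (auto simp: L_apply P_apply lie_centralizer_def)
  then show ?thesis
    using L_square[OF that(1)] c by (simp add: endo.zero_right)
qed

lemma \<kappa>_L_skew: "\<kappa> (endo_apply L x) y = - \<kappa> x (endo_apply L y)"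
  and \<kappa>_P_skew: "\<kappa> (endo_apply P x) y = - \<kappa> x (endo_apply P y)"
  by (simp_all add: L_apply P_apply killing_form_skew[OF lie])

lemma \<kappa>_commute: "\<kappa> x y = \<kappa> y x"
  by (rule killing_form_commute[OF lie])

lemma \<kappa>_\<Lambda>_inv: "\<kappa> (endo_apply \<Lambda>_inv x) y = \<kappa> x (endo_apply \<Lambda>_inv y)"
  by (metis \<Lambda>_sym \<Lambda>_\<Lambda>_inv)

lemma \<omega>_T_skew: "\<omega> (endo_apply T x) y = - \<omega> x (endo_apply T y)"
  by (simp add: \<omega>_def T_def \<kappa>_P_skew \<kappa>_\<Lambda>_inv \<kappa>.minus_right)

lemma \<omega>_L_skew: "\<omega> (endo_apply L x) y = - \<omega> x (endo_apply L y)"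
  by (metis \<omega>_def L_P_commute \<kappa>_L_skew)

lemma \<omega>_A_skew: "\<omega> (endo_apply A x) y = - \<omega> x (endo_apply A y)"
  using \<omega>_T_skew[of x y] \<omega>_L_skew[of x y]
  by (simp add: \<omega>_def A_def endo.diff_left endo.diff_right \<kappa>.diff_left \<kappa>.diff_right)

lemma \<omega>_antisym: "\<omega> x y = - \<omega> y x"
  by (metis \<omega>_def \<kappa>_P_skew \<kappa>_commute)

lemma bilinear_\<omega>: "bilinear \<omega>"
  unfolding bilinear_def \<omega>_def
  by (auto intro!: linearI simp: endo.add_right endo.scaleR_right \<kappa>.add_left \<kappa>.add_right
      \<kappa>.scaleR_left \<kappa>.scaleR_right)

lemma \<omega>_pos: "\<omega> x (endo_apply T x) > 0" if "x \<in> V" "x \<noteq> 0"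
proof -
  have "\<omega> x (endo_apply T x) = \<kappa> (\<Lambda> (endo_apply T x)) (endo_apply T x)"
    by (simp add: \<omega>_def T_def)
  also have "\<dots> = ip (endo_apply T x) (endo_apply T x)"
    by (simp add: ip_eq \<Lambda>_sym)
  finally show ?thesis
    using ip_pos T_eq_0 that by metis
qed

text \<open>Two orders: the operator whose flow is bounded comes first, \<open>A\<close> under
  stability and \<open>L\<close> in the elliptic case.\<close>

sublocale AL: skew_pair V \<omega> A L
  using V bilinear_\<omega> A_in L_in \<omega>_A_skew \<omega>_L_skew \<omega>_pos
  by unfold_locales (auto simp: A_def intro: \<omega>_antisym)

sublocale LA: skew_pair V \<omega> L A
  using V bilinear_\<omega> A_in L_in \<omega>_A_skew \<omega>_L_skew \<omega>_pos
  by unfold_locales (auto simp: A_def intro: \<omega>_antisym)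

section \<open>The linearized Euler operator and its conjugation to \<open>A\<close>\<close>

lemma ad_star_eq: "ad_star br ip u v = - endo_apply \<Lambda>_inv (br u (\<Lambda> v))"
  unfolding ad_star_def
proof (rule the_equality)
  \<comment> \<open>Existence is invariance of the Killing form; uniqueness below is definiteness of
    \<open>ip\<close>.\<close>
  show *: "\<forall>w. ip (- endo_apply \<Lambda>_inv (br u (\<Lambda> v))) w = ip v (br u w)"
  proof
    fix w
    have "ip (- endo_apply \<Lambda>_inv (br u (\<Lambda> v))) w = - \<kappa> (br u (\<Lambda> v)) w"
      by (simp add: ip_eq \<kappa>.minus_left linear_neg[OF linear_\<Lambda>] flip: \<Lambda>_sym)
    also have "\<dots> = \<kappa> (\<Lambda> v) (br u w)"
      by (simp add: killing_form_skew[OF lie])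
    finally show "ip (- endo_apply \<Lambda>_inv (br u (\<Lambda> v))) w = ip v (br u w)"
      by (simp add: ip_eq \<Lambda>_sym)
  qed
  fix x assume "\<forall>w. ip x w = ip v (br u w)"
  then have "ip x w = ip (- endo_apply \<Lambda>_inv (br u (\<Lambda> v))) w" for w
    using * by simp
  then have "ip (x - - endo_apply \<Lambda>_inv (br u (\<Lambda> v))) w = 0" for w
    unfolding ip_eq \<kappa>.diff_left by simp
  then show "x = - endo_apply \<Lambda>_inv (br u (\<Lambda> v))"
    by (metis ip_pos less_irrefl eq_iff_diff_eq_0)
qed

definition F :: "'a endo" where "F = \<Lambda>_inv * (P - L * endo_of \<Lambda>)"

lemma euler_linearization_eq: "euler_linearization br ip u0 z = endo_apply F z"
  using lie_antisym[OF lie, of z "\<Lambda> u0"]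
  by (simp add: euler_linearization_def ad_star_eq F_def endo.diff_left endo.diff_right
      endo.minus_right endo_apply_endo_of[OF linear_\<Lambda>] L_apply P_apply)

text \<open>As \<open>\<Lambda> T = P\<close> and \<open>L\<close> commutes with \<open>P\<close>,
  \<open>T\<close> intertwines \<open>A\<close> with \<open>F\<close> and carries the flow of
  \<open>A\<close> to solutions of the linearized equation.\<close>

lemma F_T: "endo_apply F (endo_apply T x) = endo_apply T (endo_apply A x)"
  by (simp add: F_def T_def A_def endo_apply_endo_of[OF linear_\<Lambda>] endo.diff_left endo.diff_right
      L_P_commute)

lemma T_flow_derivative:
  "((\<lambda>t. endo_apply T (endo_apply (exp (t *\<^sub>R A)) x)) has_vector_derivative
     endo_apply F (endo_apply T (endo_apply (exp (t *\<^sub>R A)) x))) (at t)"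
  unfolding F_T
  by (rule bounded_linear.has_vector_derivative[OF endo.bounded_linear_right exp_endo_has_vector_derivative])

lemma euler_solution_T_flow:
  "linearized_euler_solution br ip u0 (\<lambda>t. endo_apply T (endo_apply (exp (t *\<^sub>R A)) n))"
  unfolding linearized_euler_solution_def euler_linearization_eq using T_flow_derivative by blast

lemma euler_solution_cases:
  assumes z: "linearized_euler_solution br ip u0 z" "z 0 \<in> V"
  obtains n where "n \<in> V" "z = (\<lambda>t. endo_apply T (endo_apply (exp (t *\<^sub>R A)) n))"
proof -
  obtain n where n: "n \<in> V" "endo_apply T n = z 0"
    using endo_surj_on_subspace[OF V T_in T_eq_0 z(2)] by blast
  let ?z = "\<lambda>t. endo_apply T (endo_apply (exp (t *\<^sub>R A)) n)"
  have "z t = ?z t" for t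
    using linear_ode_unique[of z F t] linear_ode_unique[of ?z F t] z(1) T_flow_derivative n(2)
    by (simp add: linearized_euler_solution_def euler_linearization_eq)
  then show ?thesis
    using that n(1) by blast
qed

text \<open>If \<open>z = T n\<close> with \<open>n' = A n\<close>, then \<open>y' + L y = z\<close> and \<open>y 0 = 0\<close> have the explicit solution
  \<open>y t = n t - exp (- t L) (n 0)\<close>: the primitive of \<open>exp (t L) z\<close> is \<open>exp (t L) n\<close>, by conservation of
  momentum. So conjugate points are fixed vectors of \<open>exp (t L) exp (t A)\<close>.\<close>

definition jacobi_velocity :: "'a \<Rightarrow> real \<Rightarrow> 'a" where
  "jacobi_velocity n t = endo_apply (exp (t *\<^sub>R A)) n - endo_apply (exp (t *\<^sub>R (- L))) n"

lemma jacobi_velocity_0 [simp]: "jacobi_velocity n 0 = 0"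
  by (simp add: jacobi_velocity_def)

lemma jacobi_velocity_derivative:
  "(jacobi_velocity n has_vector_derivative
      endo_apply T (endo_apply (exp (t *\<^sub>R A)) n) - br u0 (jacobi_velocity n t)) (at t)"
proof -
  have "(jacobi_velocity n has_vector_derivative
      endo_apply A (endo_apply (exp (t *\<^sub>R A)) n) - endo_apply (- L) (endo_apply (exp (t *\<^sub>R (- L))) n)) (at t)"
    unfolding jacobi_velocity_def[abs_def]
    by (intro has_vector_derivative_diff exp_endo_has_vector_derivative)
  also have "endo_apply A (endo_apply (exp (t *\<^sub>R A)) n) - endo_apply (- L) (endo_apply (exp (t *\<^sub>R (- L))) n)
      = endo_apply T (endo_apply (exp (t *\<^sub>R A)) n) - endo_apply L (jacobi_velocity n t)"
    by (simp add: jacobi_velocity_def A_def endo.diff_left endo.diff_right endo.minus_left)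
  finally show ?thesis
    by (simp add: L_apply)
qed

lemma jacobi_velocity_unique:
  assumes y: "\<And>t. (y has_vector_derivative endo_apply T (endo_apply (exp (t *\<^sub>R A)) n) - br u0 (y t)) (at t)"
    and "y 0 = 0"
  shows "y = jacobi_velocity n"
proof
  fix t
  have "((\<lambda>t. y t - jacobi_velocity n t) has_vector_derivative endo_apply (- L) (y t - jacobi_velocity n t)) (at t)" for t
    using has_vector_derivative_diff[OF y jacobi_velocity_derivative[of n], of t]
    by (simp add: L_apply endo.minus_left endo.diff_right)
  from linear_ode_unique[OF this, of t] show "y t = jacobi_velocity n t"
    using assms(2) by (simp add: endo.zero_right)
qed

text \<open>Its derivative at 0 is \<open>T n\<close>, which is nonzero.\<close>

lemma jacobi_velocity_nonzero:
  assumes "n \<in> V" "n \<noteq> 0"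
  shows "\<exists>t. jacobi_velocity n t \<noteq> 0"
proof (rule ccontr)
  assume "\<not> ?thesis"
  then have "jacobi_velocity n = (\<lambda>t. 0)" by auto
  then have "endo_apply T n = 0"
    using vector_derivative_unique_at[OF jacobi_velocity_derivative[of n 0], of 0]
      bilinear_rzero[OF bilinear_lie[OF lie]] by simp
  then show False
    using T_eq_0[OF assms(1)] assms(2) by simp
qed

lemma jacobi_velocity_eq_0_iff:
  "jacobi_velocity n t = 0 \<longleftrightarrow> endo_apply (exp (t *\<^sub>R L)) (endo_apply (exp (t *\<^sub>R A)) n) = n"
  unfolding jacobi_velocity_def by (metis eq_iff_diff_eq_0 exp_scaleR_neg_endo scaleR_minus_right)

lemma vector_derivative_jacobi_velocity: "vector_derivative (jacobi_velocity n) (at 0) = endo_apply T n"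
  using vector_derivative_at[OF jacobi_velocity_derivative[of n 0]]
    bilinear_rzero[OF bilinear_lie[OF lie]] by simp

section \<open>Conjugate points and boundedness on \<open>V\<close>\<close>

lemma elliptic_imp_jacobi_velocity_zero:
  assumes "c < 0"
  obtains \<tau> n where "\<tau> > 0" "n \<in> V" "n \<noteq> 0" "jacobi_velocity n \<tau> = 0"
  \<comment> \<open>With \<open>c < 0\<close> the flow of \<open>L\<close> on \<open>V\<close> is
    trigonometric, hence bounded.\<close>
  using LA.bounded_flow_imp_fixed_vector[OF V_nontrivial] bounded_exp_endo_negative_square[OF L_square assms]
  unfolding jacobi_velocity_eq_0_iff by metis

lemma stable_imp_jacobi_velocity_zero:
  assumes "eulerian_stable br ip u0 V"
  obtains \<tau> n where "\<tau> > 0" "n \<in> V" "n \<noteq> 0" "jacobi_velocity n \<tau> = 0"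
proof -
  \<comment> \<open>A linear left inverse of \<open>T\<close> on \<open>V\<close> transfers
    boundedness from Euler solutions to the flow of \<open>A\<close>.\<close>
  have "inj_on (endo_apply T) V"
    by (rule endo_inj_on[OF V T_eq_0])
  then obtain g where g: "linear g" "\<And>v. v \<in> V \<Longrightarrow> g (endo_apply T v) = v"
    using linear_exists_left_inverse_on[OF linear_endo_apply V] by metis
  have "bounded (range (\<lambda>t. endo_apply (exp (t *\<^sub>R A)) n))" if n: "n \<in> V" for n
  proof -
    let ?z = "\<lambda>t. endo_apply T (endo_apply (exp (t *\<^sub>R A)) n)"
    have "bounded (range ?z)"
      using assms euler_solution_T_flow[of n] T_in[OF n] by (simp add: eulerian_stable_def)
    then have "bounded (g ` range ?z)"
      using g(1) by (simp add: bounded_linear_image linear_conv_bounded_linear)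
    moreover have "g ` range ?z = range (\<lambda>t. endo_apply (exp (t *\<^sub>R A)) n)"
      using g(2) AL.expA_in[OF n] by (simp add: image_image)
    ultimately show ?thesis by simp
  qed
  then obtain \<tau> x where x: "\<tau> > 0" "x \<in> V" "x \<noteq> 0"
    "endo_apply (exp (\<tau> *\<^sub>R A)) (endo_apply (exp (\<tau> *\<^sub>R L)) x) = x"
    using AL.bounded_flow_imp_fixed_vector[OF V_nontrivial] by metis
  show ?thesis
  proof
    \<comment> \<open>The flow of \<open>L\<close> moves a fixed vector of
      \<open>exp (\<tau> A) exp (\<tau> L)\<close> to one of the product in the opposite
      order.\<close>
    let ?n = "endo_apply (exp (\<tau> *\<^sub>R L)) x"
    show "jacobi_velocity ?n \<tau> = 0"
      using x(4) by (simp add: jacobi_velocity_eq_0_iff)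
    show "?n \<noteq> 0"
      using x(3,4) by (metis endo.zero_right)
  qed (use x LA.expA_in in auto)
qed

lemma jacobi_velocity_zero_imp_stable:
  assumes "c > 0" "dim V = 2" "\<tau> > 0" "n \<in> V" "n \<noteq> 0" "jacobi_velocity n \<tau> = 0"
  shows "eulerian_stable br ip u0 V"
  unfolding eulerian_stable_def
proof (intro allI impI, elim conjE)
  fix z assume z: "linearized_euler_solution br ip u0 z" "z 0 \<in> V"
  \<comment> \<open>A fixed vector of \<open>exp (\<tau> L) exp (\<tau> A)\<close>, moved by the
    flow of \<open>A\<close> to one of the product in the opposite order.\<close>
  let ?x = "endo_apply (exp (\<tau> *\<^sub>R A)) n"
  have "endo_apply (exp (\<tau> *\<^sub>R A)) (endo_apply (exp (\<tau> *\<^sub>R L)) ?x) = ?x"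
    using assms(6) by (simp add: jacobi_velocity_eq_0_iff)
  moreover have "?x \<noteq> 0"
    using assms(5,6) by (metis endo.zero_right jacobi_velocity_eq_0_iff)
  ultimately obtain k where k: "k < 0" "\<And>y. y \<in> V \<Longrightarrow> endo_apply A (endo_apply A y) = k *\<^sub>R y"
    using AL.fixed_vector_imp_negative_square[of "sqrt c" \<tau> ?x] L_square assms AL.expA_in
    by (metis less_imp_le real_sqrt_gt_zero real_sqrt_pow2)
  obtain m where m: "m \<in> V" "z = (\<lambda>t. endo_apply T (endo_apply (exp (t *\<^sub>R A)) m))"
    using euler_solution_cases[OF z] by blast
  have "bounded (endo_apply T ` range (\<lambda>t. endo_apply (exp (t *\<^sub>R A)) m))"
    by (intro bounded_linear_image bounded_exp_endo_negative_square[OF k(2)[OF m(1)] k(1)]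
        endo.bounded_linear_right)
  then show "bounded (range z)"
    by (simp add: m(2) image_image)
qed

end

section \<open>Passage to the group\<close>

lemma lie_algebra_of_zero:
  assumes "lie_algebra_of G br \<iota>"
  shows "\<iota> 0 = zero_tangent"
proof -
  have "\<iota> (0 *\<^sub>R 0 + 0 *\<^sub>R 0) = (\<lambda>f. 0 * \<iota> 0 f + 0 * \<iota> 0 f)"
    using assms unfolding lie_algebra_of_def by blast
  then show ?thesis by simp
qed

lemma metric_at_one_pos:
  assumes G: "lie_group G" and M: "left_invariant_metric G M" and \<iota>: "lie_algebra_of G br \<iota>"
    and u: "u \<noteq> 0"
  shows "metric_at_one G \<iota> M u u > 0"
proof -
  have "inj \<iota>" and \<iota>_in: "\<iota> u \<in> tangent_space G \<one>\<^bsub>G\<^esub>"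
    using \<iota> by (auto simp: lie_algebra_of_def bij_betw_def)
  then have "\<iota> u \<noteq> zero_tangent"
    using u lie_algebra_of_zero[OF \<iota>] by (metis injD)
  moreover have "\<one>\<^bsub>G\<^esub> \<in> carrier G"
    using G by (simp add: lie_group_def group.is_monoid monoid.one_closed)
  ultimately show ?thesis
    using M \<iota>_in unfolding left_invariant_metric_def metric_at_one_def by blast
qed

text \<open>Left translation is injective on tangent vectors at the identity because it preserves a
  positive definite metric.\<close>

lemma DL_eq_zero_iff:
  assumes G: "lie_group G" and M: "left_invariant_metric G M" and \<iota>: "lie_algebra_of G br \<iota>"
    and g: "g \<in> carrier G"
  shows "DL G g (\<iota> v) = zero_tangent \<longleftrightarrow> v = 0"
proof
  interpret group G
    using G by (simp add: lie_group_def)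
  have lin: "M g (\<lambda>f. r * X f + s * Y f) Z = r * M g X Z + s * M g Y Z"
    if "X \<in> tangent_space G g" "Y \<in> tangent_space G g" "Z \<in> tangent_space G g" for X Y Z r s
    using M g that unfolding left_invariant_metric_def by blast
  have "\<iota> v \<in> tangent_space G \<one>\<^bsub>G\<^esub>"
    using \<iota> by (auto simp: lie_algebra_of_def bij_betw_def)
  then have "M (g \<otimes>\<^bsub>G\<^esub> \<one>\<^bsub>G\<^esub>) (DL G g (\<iota> v)) (DL G g (\<iota> v)) = metric_at_one G \<iota> M v v"
    using M g one_closed unfolding left_invariant_metric_def metric_at_one_def by blast
  moreover have "zero_tangent \<in> tangent_space G g"
    by (simp add: tangent_space_def)
  then have "M g zero_tangent zero_tangent = 0"
    using lin[of zero_tangent zero_tangent zero_tangent 0 0] by simp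
  moreover assume "DL G g (\<iota> v) = zero_tangent"
  ultimately have "metric_at_one G \<iota> M v v = 0"
    using g by simp
  then show "v = 0"
    using metric_at_one_pos[OF G M \<iota>, of v] by auto
next
  assume "v = 0"
  then show "DL G g (\<iota> v) = zero_tangent"
    by (simp add: DL_def lie_algebra_of_zero[OF \<iota>])
qed

theorem theorem4p13:
  fixes G :: "('g, 'a::euclidean_space, 'm) manifold_monoid_scheme"
    and br :: "'a \<Rightarrow> 'a \<Rightarrow> 'a"
    and \<iota> :: "'a \<Rightarrow> 'g tangent"
    and M :: "'g \<Rightarrow> 'g tangent \<Rightarrow> 'g tangent \<Rightarrow> real"
    and \<Lambda> :: "'a \<Rightarrow> 'a"
    and u0 :: 'a
    and \<gamma> :: "real \<Rightarrow> 'g"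
    and c :: real
    and V :: "'a set"
  assumes "lie_group G"
    and "lie_algebra_of G br \<iota>"
    and "lie_semisimple br"
    and "left_invariant_metric G M"
    and "linear \<Lambda>" and "bij \<Lambda>"
    and "\<And>u v. killing_form br (\<Lambda> u) v = killing_form br u (\<Lambda> v)"
    and "\<And>u v. metric_at_one G \<iota> M u v = killing_form br u (\<Lambda> v)"
    and "regular_element br u0" and "semisimple_element br u0"
    and "regular_element br (\<Lambda> u0)" and "br u0 (\<Lambda> u0) = 0"
    and "c \<noteq> 0" and "V = {v. br u0 (br u0 v) = c *\<^sub>R v}" and "V \<noteq> {0}"
    and "\<Lambda> ` V \<subseteq> V"
    and "one_parameter_subgroup G (\<iota> u0) \<gamma>"
  shows
    "((\<forall>k. complex_eigenvalue_on (br u0) V k \<longrightarrow> Re k = 0) \<longrightarrow>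
        (\<exists>\<tau>. conjugate_time G br \<iota> M u0 \<gamma> UNIV \<tau>)) \<and>
     ((\<forall>k. complex_eigenvalue_on (br u0) V k \<longrightarrow> Im k = 0) \<longrightarrow>
        (eulerian_stable br (metric_at_one G \<iota> M) u0 V \<longrightarrow>
           (\<exists>\<tau>. conjugate_time G br \<iota> M u0 \<gamma> V \<tau>)) \<and>
        (dim V = 2 \<longrightarrow>
           (\<exists>\<tau>. conjugate_time G br \<iota> M u0 \<gamma> V \<tau>) \<longrightarrow>
           eulerian_stable br (metric_at_one G \<iota> M) u0 V))"
proof -
  let ?ip = "metric_at_one G \<iota> M"
  have lie: "lie_algebra br"
    using assms(2) by (simp add: lie_algebra_of_def)
  have "\<gamma> t \<in> carrier G" for t
    using assms(1,17)
    by (auto simp: one_parameter_subgroup_def smooth_map_def lie_group_def continuous_map_def)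
  then have DL_zero: "DL G (\<gamma> t) (\<iota> v) = zero_tangent \<longleftrightarrow> v = 0" for t v
    using DL_eq_zero_iff[OF assms(1,4,2)] by blast
  note ip_pos = metric_at_one_pos[OF assms(1,4,2)]
  interpret euler_eigenspace br ?ip \<Lambda> u0 c V
    by (rule euler_eigenspace.intro) (fact lie ip_pos assms)+
  \<comment> \<open>Since \<open>y' 0 = T n\<close> lies in \<open>V\<close>, the same Jacobi field
    serves both \<open>W = V\<close> and \<open>W = UNIV\<close>.\<close>
  have conjugate_time_if: "conjugate_time G br \<iota> M u0 \<gamma> W \<tau>"
    if "\<tau> > 0" "n \<in> V" "n \<noteq> 0" "jacobi_velocity n \<tau> = 0" "V \<subseteq> W" for \<tau> n W
    unfolding conjugate_time_def
  proof (intro conjI exI[of _ "jacobi_velocity n"]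
      exI[of _ "\<lambda>t. DL G (\<gamma> t) (\<iota> (jacobi_velocity n t))"])
    show "jacobi_field G br \<iota> M u0 \<gamma> (jacobi_velocity n) (\<lambda>t. DL G (\<gamma> t) (\<iota> (jacobi_velocity n t)))"
      unfolding jacobi_field_def using euler_solution_T_flow jacobi_velocity_derivative by blast
    show "vector_derivative (jacobi_velocity n) (at 0) \<in> W"
      using that T_in by (auto simp: vector_derivative_jacobi_velocity)
    show "\<exists>t. DL G (\<gamma> t) (\<iota> (jacobi_velocity n t)) \<noteq> zero_tangent"
      using jacobi_velocity_nonzero[OF that(2,3)] by (simp add: DL_zero)
  qed (use that in \<open>auto simp: DL_zero\<close>)
  \<comment> \<open>Conversely, \<open>y 0 = 0\<close> gives \<open>y' 0 = z 0\<close>, so a Jacobi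
    field with initial velocity in \<open>V\<close> comes from a \<open>T\<close>-image of the flow
    of \<open>A\<close> on \<open>V\<close>.\<close>
  have conjugate_time_cases: "\<exists>n\<in>V. n \<noteq> 0 \<and> jacobi_velocity n \<tau> = 0"
    if conj: "conjugate_time G br \<iota> M u0 \<gamma> V \<tau>" for \<tau>
  proof -
    obtain y J z where J: "\<And>t. J t = DL G (\<gamma> t) (\<iota> (y t))" "\<exists>t. J t \<noteq> zero_tangent"
        "J 0 = zero_tangent" "J \<tau> = zero_tangent"
      and z: "linearized_euler_solution br ?ip u0 z"
      and y: "\<And>t. (y has_vector_derivative z t - br u0 (y t)) (at t)" "vector_derivative y (at 0) \<in> V"
      using conj unfolding conjugate_time_def jacobi_field_def by blast
    have y0: "y 0 = 0" "y \<tau> = 0" "\<exists>t. y t \<noteq> 0"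
      using J by (auto simp: DL_zero)
    then have "z 0 \<in> V"
      using vector_derivative_at[OF y(1)[of 0]] y(2) bilinear_rzero[OF bilinear_lie[OF lie]] by simp
    then obtain n where n: "n \<in> V" "z = (\<lambda>t. endo_apply T (endo_apply (exp (t *\<^sub>R A)) n))"
      using euler_solution_cases[OF z] by blast
    have "y = jacobi_velocity n"
      using y(1) y0(1) by (intro jacobi_velocity_unique) (simp_all add: n(2))
    moreover from this have "n \<noteq> 0"
      using y0(3) by (auto simp: jacobi_velocity_def endo.zero_right)
    ultimately show ?thesis
      using n(1) y0(2) by blast
  qed
  note eigenvalue = complex_eigenvalue_on_square_eigenspace[OF linear_ad[OF lie] assms(14,15)]
  show ?thesis
  proof (intro conjI impI)
    assume Re: "\<forall>k. complex_eigenvalue_on (br u0) V k \<longrightarrow> Re k = 0"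
    \<comment> \<open>For \<open>c > 0\<close>, one of the real numbers \<open>sqrt c\<close> and
      \<open>- sqrt c\<close> would be an eigenvalue.\<close>
    have "c < 0"
    proof (rule ccontr)
      assume "\<not> c < 0"
      then have "c > 0"
        using assms(13) by simp
      then have "(complex_of_real (sqrt c))\<^sup>2 = complex_of_real c"
        by (simp flip: of_real_power)
      then obtain k' where "k' = complex_of_real (sqrt c) \<or> k' = - complex_of_real (sqrt c)"
        "complex_eigenvalue_on (br u0) V k'"
        by (rule eigenvalue)
      then show False
        using Re \<open>c > 0\<close> by auto
    qed
    then show "\<exists>\<tau>. conjugate_time G br \<iota> M u0 \<gamma> UNIV \<tau>"
      using elliptic_imp_jacobi_velocity_zero conjugate_time_if by (metis subset_UNIV)
  next
    assume "eulerian_stable br ?ip u0 V"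
    then show "\<exists>\<tau>. conjugate_time G br \<iota> M u0 \<gamma> V \<tau>"
      using stable_imp_jacobi_velocity_zero conjugate_time_if by (metis order_refl)
  next
    assume Im: "\<forall>k. complex_eigenvalue_on (br u0) V k \<longrightarrow> Im k = 0" and dim: "dim V = 2"
      and "\<exists>\<tau>. conjugate_time G br \<iota> M u0 \<gamma> V \<tau>"
    then obtain \<tau> where \<tau>: "conjugate_time G br \<iota> M u0 \<gamma> V \<tau>" by blast
    \<comment> \<open>For \<open>c < 0\<close>, one of the two imaginary square roots of
      \<open>c\<close> would be an eigenvalue.\<close>
    have "c > 0"
    proof (rule ccontr)
      assume "\<not> c > 0"
      then have "c < 0"
        using assms(13) by simp
      then have "(\<i> * complex_of_real (sqrt (- c)))\<^sup>2 = complex_of_real c"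
        by (simp add: power_mult_distrib flip: of_real_power)
      then obtain k' where "k' = \<i> * complex_of_real (sqrt (- c)) \<or> k' = - (\<i> * complex_of_real (sqrt (- c)))"
        "complex_eigenvalue_on (br u0) V k'"
        by (rule eigenvalue)
      then show False
        using Im \<open>c < 0\<close> by auto
    qed
    moreover have "\<tau> > 0"
      using \<tau> by (simp add: conjugate_time_def)
    ultimately show "eulerian_stable br ?ip u0 V"
      using conjugate_time_cases[OF \<tau>] dim jacobi_velocity_zero_imp_stable by blast
  qed
qed

end
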